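(* Let $\{C_p\}_{p}$ and $\{D_p\}_{p}$ be two sequences of integers indexed by the prime numbers $p$. Suppose that $C_p\neq 0$ for all $p$ and that $C_p=o\big(p^{1/12}(\log p)^{-2/3}\big)$ as $p\to\infty$. Then, as $p\to\infty$ through the primes, \[ \frac{1}{p}\sum_{b=1}^{p-1}\left|\frac{\mathfrak q_p(b)}{p}-\Big\{C_p\frac{b}{p}+D_p\Big\}\right| = \frac{1}{3}+O\Big(C_p^{3/5}\,p^{-1/20}(\log p)^{2/5}\Big), \] where $\{x\}$ denotes the fractional part of the real number $x$.
   Context: For a prime $p$ and an integer $n$ with $\gcd(n,p)=1$, the Fermat quotient modulo $p$ is $\mathfrak q_p(n)$, defined as the unique representative in $\{0,1,\dots,p-1\}$ of $\frac{n^{p-1}-1}{p}$ modulo $p$ (note $\frac{n^{p-1}-1}{p}$ is an integer by Fermat's little theorem). *)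

theory Defs
  imports Complex_Main "HOL-Computational_Algebra.Primes" "HOL-Library.Landau_Symbols"
begin

(* The division is exact, by Fermat's little theorem, when p is prime and n is coprime to p;
   only such arguments are meaningful. *)
definition fermat_quotient :: "nat \<Rightarrow> int \<Rightarrow> int" where
  "fermat_quotient p n = ((n ^ (p - 1) - 1) div int p) mod int p"

definition primes_at_top :: "nat filter" where
  "primes_at_top = inf at_top (principal {p. prime p})"

end

(* Write q for the Fermat quotient, r(n) = C n mod p and G_s(m) = |m - s| / p, so that
   the sum in question is that of G_{r(n)}(q(n)) over 0 < n < p. Replacing n by n + a b inside q
   only, and averaging over a <= A, b <= B, costs O(|C| A B), because r is a bijection of Z/p that
   moves by C a b. Expand G_s in additive characters mod p: the constant terms average to p/3, and
   the other coefficients have l1 norm O(log p). Now chi(n) = e(c q(n) / p) is a multiplicative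
   character mod p^2, so chi(n + a b) = chi(a) chi(n/a + b), and Hoelder's inequality bounds the
   remaining sums (Burgess' method) by the number of solutions of n a' = n' a and by the complete
   fourth moment, over x mod p^2, of the sum of chi(x + b). With x = u + p v, chi(x + b) is
   chi(u + b) times an additive character of v with frequency -c / (u + b), so summing over v leaves
   the quadruples with 1/(u+b1) + 1/(u+b2) = 1/(u+b3) + 1/(u+b4) mod p, a quadratic congruence in u
   unless (b1, b2) is a permutation of (b3, b4). No Weil bound is needed. With A = p^(5/12) and
   B = p^(1/2) the error is O(|C| p^(-1/12)) + O(p^(-5/48) log^2 p), and C = o(p^(1/12)) turns the
   first term into O(|C|^(3/5) p^(-1/20)). *)

theory Submission
  imports Defs "HOL-Number_Theory.Residues" "HOL-Analysis.Analysis" "HOL-Real_Asymp.Real_Asymp"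
begin

section \<open>Additive characters\<close>

definition ee :: "nat \<Rightarrow> int \<Rightarrow> complex" where
  "ee p t = cis (2 * pi * real_of_int t / real p)"

lemma norm_ee [simp]: "norm (ee p t) = 1"
  by (simp add: ee_def)

lemma ee_0 [simp]: "ee p 0 = 1"
  by (simp add: ee_def)

lemma ee_add: "ee p (s + t) = ee p s * ee p t"
  by (simp add: ee_def cis_mult distrib_left add_divide_distrib)

lemma cnj_ee: "cnj (ee p t) = ee p (- t)"
  by (simp add: ee_def cis_cnj)

lemma ee_multiple:
  assumes "p > 0"
  shows "ee p (int p * t) = 1"
proof -
  have "2 * pi * real_of_int (int p * t) / real p = 2 * pi * real_of_int t"
    using assms by simp
  then show ?thesis
    unfolding ee_def by (metis Ints_of_int cis_multiple_2pi)
qed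

lemma ee_cong:
  assumes "p > 0" "[s = t] (mod int p)"
  shows "ee p s = ee p t"
proof -
  obtain k where "s = t + int p * k"
    using assms(2) by (metis cong_iff_lin cong_sym)
  then show ?thesis
    using ee_multiple[OF assms(1)] by (simp add: ee_add)
qed

lemma ee_eq_1_iff:
  assumes "p > 0"
  shows "ee p t = 1 \<longleftrightarrow> int p dvd t"
proof
  assume "ee p t = 1"
  then have "cos (2 * pi * real_of_int t / real p) = 1"
    by (simp add: ee_def complex_eq_iff)
  then obtain k :: int where "2 * pi * real_of_int t / real p = k * 2 * pi"
    using cos_one_2pi_int by auto
  then have "real_of_int t = real_of_int (k * int p)"
    using assms by (simp add: field_simps)
  then have "t = k * int p"
    by linarith
  then show "int p dvd t"
    by simp
next
  assume "int p dvd t"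
  then show "ee p t = 1"
    using ee_multiple[OF assms] by auto
qed

lemma ee_power: "ee p t ^ n = ee p (int n * t)"
proof -
  have "real n * (2 * pi * real_of_int t / real p) = 2 * pi * real_of_int (int n * t) / real p"
    by simp
  then show ?thesis
    unfolding ee_def Complex.DeMoivre by (simp add: mult_ac)
qed

lemma sum_ee_orthogonality:
  assumes "p > 0"
  shows "(\<Sum>v = 0..<int p. ee p (v * t)) = (if int p dvd t then of_nat p else 0)"
proof -
  have "(\<Sum>v = 0..<int p. ee p (v * t)) = (\<Sum>n<p. ee p t ^ n)"
    unfolding ee_power
    by (rule sum.reindex_bij_witness[of _ int nat]) auto
  also have "\<dots> = (if int p dvd t then of_nat p else 0)"
  proof (cases "ee p t = 1")
    case True
    then have "(\<Sum>n<p. ee p t ^ n) = of_nat p"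
      by simp
    then show ?thesis using True ee_eq_1_iff[OF assms, of t] by simp
  next
    case False
    have "ee p t ^ p = 1"
      using ee_multiple[OF assms] by (simp add: ee_power)
    then show ?thesis
      using False ee_eq_1_iff[OF assms] geometric_sum[OF False, of p] by simp
  qed
  finally show ?thesis .
qed

text \<open>Expanding the fourth power and summing over \<open>v\<close> leaves only the quadruples with equal frequency sums.\<close>

lemma fourth_moment_le_count:
  fixes z :: "'a \<Rightarrow> complex" and l :: "'a \<Rightarrow> int"
  assumes "p > 0" "finite S" "\<And>b. b \<in> S \<Longrightarrow> norm (z b) \<le> 1"
  shows "(\<Sum>v = 0..<int p. norm (\<Sum>b\<in>S. z b * ee p (v * l b)) ^ 4)
    \<le> real p * real (card {(b1,b2,b3,b4) \<in> S \<times> S \<times> S \<times> S. [l b1 + l b2 = l b3 + l b4] (mod int p)})"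
proof -
  define T where "T v = (\<Sum>b\<in>S. z b * ee p (v * l b))" for v
  define Q where "Q = S \<times> S \<times> S \<times> S"
  define w where "w = (\<lambda>(b1,b2,b3,b4). z b1 * z b2 * cnj (z b3) * cnj (z b4))"
  define m where "m = (\<lambda>(b1,b2,b3,b4). l b1 + l b2 - l b3 - l b4)"
  have finQ: "finite Q"
    using assms(2) by (simp add: Q_def)
  have "complex_of_real (norm (T v) ^ 4) = (\<Sum>q\<in>Q. w q * ee p (v * m q))" for v
  proof -
    have "complex_of_real (norm (T v) ^ 4) = (T v * cnj (T v)) ^ 2"
      unfolding complex_norm_square[symmetric] by (simp flip: of_real_power power_mult)
    also have "\<dots> = T v * (T v * (cnj (T v) * cnj (T v)))"
      by (simp add: power2_eq_square mult_ac)
    also have "\<dots> = (\<Sum>(b1,b2,b3,b4)\<in>Q. (z b1 * ee p (v * l b1)) * ((z b2 * ee p (v * l b2)) *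
        (cnj (z b3 * ee p (v * l b3)) * cnj (z b4 * ee p (v * l b4)))))"
      unfolding T_def Q_def cnj_sum
      by (simp only: sum.cartesian_product[symmetric] sum_distrib_left[symmetric] sum_distrib_right[symmetric])
    also have "\<dots> = (\<Sum>q\<in>Q. w q * ee p (v * m q))"
    proof (rule sum.cong[OF refl], clarify)
      fix b1 b2 b3 b4
      have "v * m (b1, b2, b3, b4) = v * l b1 + v * l b2 + - (v * l b3) + - (v * l b4)"
        by (simp add: m_def algebra_simps)
      then show "(z b1 * ee p (v * l b1)) * ((z b2 * ee p (v * l b2)) *
          (cnj (z b3 * ee p (v * l b3)) * cnj (z b4 * ee p (v * l b4))))
          = w (b1, b2, b3, b4) * ee p (v * m (b1, b2, b3, b4))"
        by (simp only: ee_add w_def complex_cnj_mult cnj_ee case_prod_conv mult_ac)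
    qed
    finally show ?thesis .
  qed
  then have "complex_of_real (\<Sum>v = 0..<int p. norm (T v) ^ 4)
      = (\<Sum>v = 0..<int p. \<Sum>q\<in>Q. w q * ee p (v * m q))"
    by simp
  also have "\<dots> = (\<Sum>q\<in>Q. w q * (\<Sum>v = 0..<int p. ee p (v * m q)))"
    by (subst sum.swap) (simp add: sum_distrib_left)
  also have "\<dots> = (\<Sum>q\<in>{q\<in>Q. int p dvd m q}. w q * of_nat p)"
    using finQ by (intro sum.mono_neutral_cong_right) (auto simp: sum_ee_orthogonality[OF assms(1)] simp del: mult_eq_0_iff)
  finally have eq: "complex_of_real (\<Sum>v = 0..<int p. norm (T v) ^ 4)
      = (\<Sum>q\<in>{q\<in>Q. int p dvd m q}. w q * of_nat p)" .
  \<comment> \<open>The left side is a nonnegative real, hence its own norm; each surviving weight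
    \<open>w q\<close> has norm at most 1.\<close>
  have "(\<Sum>v = 0..<int p. norm (T v) ^ 4) = norm (complex_of_real (\<Sum>v = 0..<int p. norm (T v) ^ 4))"
    unfolding norm_of_real by (simp add: sum_nonneg)
  also have "\<dots> \<le> (\<Sum>q\<in>{q\<in>Q. int p dvd m q}. real p)"
    unfolding eq
  proof (rule sum_norm_le)
    fix q assume "q \<in> {q\<in>Q. int p dvd m q}"
    then have "norm (w q) \<le> 1"
      using assms(3) by (auto simp: Q_def w_def norm_mult intro!: mult_le_one)
    then show "norm (w q * of_nat p) \<le> real p"
      by (simp add: norm_mult mult_left_le_one_le)
  qed
  also have "\<dots> = real p * real (card {q\<in>Q. int p dvd m q})"
    by simp
  also have "{q\<in>Q. int p dvd m q} = {(b1,b2,b3,b4) \<in> S \<times> S \<times> S \<times> S. [l b1 + l b2 = l b3 + l b4] (mod int p)}"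
    by (auto simp: Q_def m_def cong_iff_dvd_diff algebra_simps)
  finally show ?thesis
    by (simp add: T_def)
qed

section \<open>Fermat quotients modulo \<open>p\<close>\<close>

text \<open>Writing the power as 1 + p k removes the division from the definition, so that the later
  identities become congruences for k.\<close>

lemma fermat_quotient_eq:
  assumes "prime p" "\<not> int p dvd n"
  obtains k where "n ^ (p - 1) = 1 + int p * k" "fermat_quotient p n = k mod int p"
proof -
  have "[n ^ (p - 1) = 1] (mod int p)"
  proof -
    \<comment> \<open>\<open>fermat_theorem\<close> speaks of naturals, so n is first replaced by
      its residue.\<close>
    define a where "a = nat (n mod int p)"
    have p0: "p > 0"
      using assms(1) prime_gt_0_nat by blast
    have a: "int a = n mod int p"
      using p0 by (simp add: a_def)
    have "\<not> int p dvd int a"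
      using assms(2) unfolding a by (simp add: dvd_mod_iff)
    then have "[a ^ (p - 1) = 1] (mod p)"
      using assms(1) fermat_theorem int_dvd_int_iff by blast
    then have "[int a ^ (p - 1) = 1] (mod int p)"
      by (metis cong_int_iff of_nat_1 of_nat_power)
    then show ?thesis
      unfolding a unique_euclidean_semiring_class.cong_def power_mod .
  qed
  then obtain k where k: "n ^ (p - 1) = 1 + int p * k"
    by (metis cong_iff_lin cong_sym)
  show ?thesis
    by (rule that[OF k]) (use k assms(1) in \<open>simp add: fermat_quotient_def\<close>)
qed

lemma fermat_quotient_bounds:
  assumes "p > 0"
  shows "0 \<le> fermat_quotient p n" "fermat_quotient p n < int p"
  using assms by (auto simp: fermat_quotient_def)

text \<open>(1 + p k)(1 + p l) = 1 + p (k + l + p k l), so the quotient behaves like a logarithm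
  modulo p.\<close>

lemma fermat_quotient_mult:
  assumes "prime p" "\<not> int p dvd m" "\<not> int p dvd n"
  shows "[fermat_quotient p (m * n) = fermat_quotient p m + fermat_quotient p n] (mod int p)"
proof -
  have p: "prime (int p)" "int p > 0"
    using assms(1) prime_gt_0_nat by auto
  have mn: "\<not> int p dvd m * n"
    using assms p prime_dvd_mult_iff by blast
  obtain k where k: "m ^ (p - 1) = 1 + int p * k" "fermat_quotient p m = k mod int p"
    using fermat_quotient_eq assms by blast
  obtain l where l: "n ^ (p - 1) = 1 + int p * l" "fermat_quotient p n = l mod int p"
    using fermat_quotient_eq assms by blast
  obtain j where j: "(m * n) ^ (p - 1) = 1 + int p * j" "fermat_quotient p (m * n) = j mod int p"
    using fermat_quotient_eq assms mn by blast
  have "int p * j = int p * (k + l + int p * k * l)"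
    using j(1) unfolding power_mult_distrib k(1) l(1) by (simp add: algebra_simps)
  then have "j = k + l + int p * k * l"
    using p by (metis less_irrefl mult_left_cancel)
  then show ?thesis
    unfolding k l j unique_euclidean_semiring_class.cong_def by (simp add: mod_simps mult.assoc)
qed

text \<open>First-order binomial expansion. The extra factor u on both sides avoids the exponent n -
  1 in the linear term.\<close>

lemma power_add_cong_square:
  fixes u w :: int
  shows "[u * (u + w) ^ n = u * u ^ n + int n * u ^ n * w] (mod w\<^sup>2)"
proof (induction n)
  case (Suc n)
  have "[u * (u + w) ^ Suc n = (u * u ^ n + int n * u ^ n * w) * (u + w)] (mod w\<^sup>2)"
    using cong_mult[OF Suc.IH cong_refl[of "u + w"]] by (simp add: mult_ac)
  moreover have "(u * u ^ n + int n * u ^ n * w) * (u + w)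
      = u * u ^ Suc n + int (Suc n) * u ^ Suc n * w + w\<^sup>2 * (int n * u ^ n)"
    by (simp add: algebra_simps power2_eq_square)
  ultimately show ?case
    by (metis unique_euclidean_semiring_class.cong_def mod_mult_self2)
qed simp

text \<open>Modulo p^2, raising u + p v to the power p - 1 adds (p - 1) u^(p-2) p v, so the quotient
  changes by -v/u. Multiplying through by u avoids inverses.\<close>

lemma fermat_quotient_shift:
  assumes "prime p" "\<not> int p dvd u"
  shows "[u * fermat_quotient p (u + int p * v) = u * fermat_quotient p u - v] (mod int p)"
proof -
  have p: "prime (int p)" "int p > 0"
    using assms(1) prime_gt_0_nat by auto
  have uv: "\<not> int p dvd u + int p * v"
    using assms by (simp add: dvd_add_left_iff)
  obtain k where k: "u ^ (p - 1) = 1 + int p * k" "fermat_quotient p u = k mod int p"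
    using fermat_quotient_eq assms by blast
  obtain l where l: "(u + int p * v) ^ (p - 1) = 1 + int p * l"
      "fermat_quotient p (u + int p * v) = l mod int p"
    using fermat_quotient_eq assms uv by blast
  have "[u * (u + int p * v) ^ (p - 1) = u * u ^ (p - 1) + int (p - 1) * u ^ (p - 1) * (int p * v)] (mod (int p * v)\<^sup>2)"
    by (rule power_add_cong_square)
  then have "[u * (u + int p * v) ^ (p - 1) = u * u ^ (p - 1) + int (p - 1) * u ^ (p - 1) * (int p * v)] (mod (int p)\<^sup>2)"
    by (rule cong_dvd_modulus) (simp add: power_mult_distrib)
  then have "(int p)\<^sup>2 dvd u * (1 + int p * l) - (u * (1 + int p * k) + (int p - 1) * (1 + int p * k) * (int p * v))"
    unfolding k(1) l(1) cong_iff_dvd_diff using p by (simp add: of_nat_diff)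
  \<comment> \<open>Collecting the multiples of p^2 leaves p times the wanted relation; one factor p
    then cancels against the modulus.\<close>
  also have "u * (1 + int p * l) - (u * (1 + int p * k) + (int p - 1) * (1 + int p * k) * (int p * v))
     = int p * (u * l - u * k + v) + (int p)\<^sup>2 * (v * k - v * (1 + int p * k))"
    by (simp add: algebra_simps power2_eq_square)
  finally have "int p * int p dvd int p * (u * l - u * k + v)"
    by (simp add: dvd_add_left_iff power2_eq_square)
  then have "int p dvd u * l - u * k + v"
    using p by simp
  then have "[u * l = u * k - v] (mod int p)"
    by (simp add: cong_iff_dvd_diff algebra_simps)
  then show ?thesis
    unfolding k l unique_euclidean_semiring_class.cong_def by (metis mod_diff_left_eq mod_mult_right_eq)
qed

section \<open>The complete fourth moment modulo \<open>p\<^sup>2\<close>\<close>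

text \<open>Divided differences: three distinct roots make \<open>a * (s + t) + b\<close> vanish
  modulo q for each pair of them, hence a, then b, then c. The leading coefficient may vanish modulo
  q, as long as not all three do.\<close>

lemma quadratic_cong_card_le_2:
  fixes q :: int
  assumes "prime q" "\<not> (q dvd a \<and> q dvd b \<and> q dvd c)"
  shows "card {x \<in> {0..<q}. q dvd a * x\<^sup>2 + b * x + c} \<le> 2"
proof (rule ccontr)
  assume "\<not> ?thesis"
  then have "3 \<le> card {x \<in> {0..<q}. q dvd a * x\<^sup>2 + b * x + c}"
    by linarith
  then obtain X where X: "X \<subseteq> {x \<in> {0..<q}. q dvd a * x\<^sup>2 + b * x + c}" "card X = 3"
    by (rule obtain_subset_with_card_n)
  then obtain x y z where xyz: "X = {x,y,z}" "x \<noteq> y" "x \<noteq> z" "y \<noteq> z"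
    by (metis card_3_iff)
  have ndvd: "\<not> q dvd s - t" if "s \<in> X" "t \<in> X" "s \<noteq> t" for s t
  proof -
    have "0 \<le> s" "s < q" "0 \<le> t" "t < q"
      using that X by auto
    then show ?thesis
      using that(3) cong_less_imp_eq_int unfolding cong_iff_dvd_diff[symmetric] by blast
  qed
  have root: "q dvd a * s\<^sup>2 + b * s + c" if "s \<in> X" for s
    using that X by auto
  have lin: "q dvd a * (s + t) + b" if "s \<in> X" "t \<in> X" "s \<noteq> t" for s t
  proof -
    have "q dvd (a * s\<^sup>2 + b * s + c) - (a * t\<^sup>2 + b * t + c)"
      by (intro dvd_diff root that)
    also have "(a * s\<^sup>2 + b * s + c) - (a * t\<^sup>2 + b * t + c) = (s - t) * (a * (s + t) + b)"
      by (simp add: algebra_simps power2_eq_square)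
    finally show ?thesis
      using ndvd[OF that] prime_dvd_mult_iff[OF assms(1)] by simp
  qed
  have "q dvd (a * (x + y) + b) - (a * (x + z) + b)"
    by (intro dvd_diff lin) (use xyz in auto)
  also have "(a * (x + y) + b) - (a * (x + z) + b) = a * (y - z)"
    by (simp add: algebra_simps)
  finally have a: "q dvd a"
    using ndvd[of y z] xyz prime_dvd_mult_iff[OF assms(1)] by simp
  moreover have "q dvd a * (x + y) + b"
    by (rule lin) (use xyz in auto)
  ultimately have b: "q dvd b"
    by (simp add: dvd_add_right_iff)
  have "q dvd a * x\<^sup>2 + b * x + c"
    by (rule root) (use xyz in auto)
  with a b have "q dvd c"
    by (simp add: dvd_add_right_iff)
  with a b assms(2) show False
    by blast
qed

section \<open>The characters chi modulo \<open>p\<^sup>2\<close> built from the Fermat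
  quotient\<close>

definition chi :: "nat \<Rightarrow> int \<Rightarrow> int \<Rightarrow> complex" where
  "chi p c n = (if int p dvd n then 0 else ee p (c * fermat_quotient p n))"

lemma norm_chi_le: "norm (chi p c n) \<le> 1"
  by (simp add: chi_def)

text \<open>The value 0 at multiples of p makes chi completely multiplicative on all
  integers.\<close>

lemma chi_mult:
  assumes "prime p"
  shows "chi p c (m * n) = chi p c m * chi p c n"
proof -
  have p: "p > 0" "prime (int p)"
    using assms prime_gt_0_nat by auto
  show ?thesis
  proof (cases "int p dvd m \<or> int p dvd n")
    case True
    then show ?thesis
      by (auto simp: chi_def)
  next
    case False
    then have "\<not> int p dvd m * n"
      using prime_dvd_mult_iff[OF p(2)] by simp
    moreover have "ee p (c * fermat_quotient p (m * n)) = ee p (c * fermat_quotient p m + c * fermat_quotient p n)"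
      using fermat_quotient_mult[OF assms, of m n] False
      by (intro ee_cong p) (simp add: cong_scalar_left flip: distrib_left)
    ultimately show ?thesis
      using False by (simp add: chi_def ee_add)
  qed
qed

lemma cong_cancel_prime:
  fixes q :: int
  assumes "prime q" "\<not> q dvd u" "[u * x = u * y] (mod q)"
  shows "[x = y] (mod q)"
proof -
  have "q dvd u * (x - y)"
    using assms(3) by (simp add: cong_iff_dvd_diff algebra_simps)
  then show ?thesis
    using assms(1,2) by (simp add: prime_dvd_mult_iff cong_iff_dvd_diff)
qed

text \<open>Here l is -1/u modulo p, so the quotient at u + p v is that at u plus v l. Within a
  residue class modulo p, chi is therefore a constant times an additive character of v with
  frequency c l.\<close>

lemma chi_shift:
  assumes "prime p" "\<not> int p dvd u" "[u * l = - 1] (mod int p)"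
  shows "chi p c (u + int p * v) = chi p c u * ee p (v * (c * l))"
proof -
  have p: "p > 0" "prime (int p)"
    using assms prime_gt_0_nat by auto
  have "[u * (fermat_quotient p u + v * l) = u * fermat_quotient p u - v] (mod int p)"
  proof -
    have "[u * fermat_quotient p u + v * (u * l) = u * fermat_quotient p u + v * (- 1)] (mod int p)"
      by (intro cong_add cong_mult assms(3) cong_refl)
    then show ?thesis
      by (simp add: algebra_simps)
  qed
  then have "[u * fermat_quotient p (u + int p * v) = u * (fermat_quotient p u + v * l)] (mod int p)"
    using fermat_quotient_shift[OF assms(1,2), of v] by (metis cong_trans cong_sym)
  then have "[fermat_quotient p (u + int p * v) = fermat_quotient p u + v * l] (mod int p)"
    using cong_cancel_prime[OF p(2) assms(2)] by blast
  then have "[c * fermat_quotient p (u + int p * v) = c * (fermat_quotient p u + v * l)] (mod int p)"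
    by (rule cong_scalar_left)
  then have "ee p (c * fermat_quotient p (u + int p * v)) = ee p (c * (fermat_quotient p u + v * l))"
    by (rule ee_cong[OF p(1)])
  also have "c * (fermat_quotient p u + v * l) = c * fermat_quotient p u + v * (c * l)"
    by (simp add: algebra_simps)
  finally show ?thesis
    using assms(2) by (simp add: chi_def ee_add dvd_add_left_iff)
qed

text \<open>A shift by a multiple of p^2 is the case of \<open>chi_shift\<close> in which v is
  divisible by p, and then the additive factor is 1.\<close>

lemma chi_cong:
  assumes "prime p" "[m = n] (mod (int p)\<^sup>2)"
  shows "chi p c m = chi p c n"
proof -
  have p: "p > 0" "prime (int p)"
    using assms prime_gt_0_nat by auto
  obtain k where "m = n + (int p)\<^sup>2 * k"
    using assms(2) by (metis cong_iff_lin cong_sym)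
  then have m: "m = n + int p * (int p * k)"
    by (simp add: power2_eq_square)
  show ?thesis
  proof (cases "int p dvd n")
    case True
    then show ?thesis
      by (simp add: chi_def m)
  next
    case False
    then have "coprime n (int p)"
      using p(2) by (metis coprime_commute prime_imp_coprime)
    then obtain l where "[n * l = 1] (mod int p)"
      using cong_solve_coprime_int by blast
    then have "[n * (- l) = - 1] (mod int p)"
      using cong_minus_minus_iff by fastforce
    then show ?thesis
      using chi_shift[OF assms(1) False, of "- l" c "int p * k"] ee_multiple[OF p(1), of "k * (c * - l)"]
      by (simp add: m mult.assoc)
  qed
qed

section \<open>Counting the quadruples of shifts with equal sums of reciprocals\<close>

definition neg_inv :: "nat \<Rightarrow> int \<Rightarrow> int" where
  "neg_inv p n = (SOME l. [n * l = - 1] (mod int p))"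

lemma neg_inv:
  assumes "prime p" "\<not> int p dvd n"
  shows "[n * neg_inv p n = - 1] (mod int p)"
proof -
  have "coprime n (int p)"
    using assms by (metis coprime_commute prime_imp_coprime prime_nat_int_transfer)
  then obtain l where "[n * l = 1] (mod int p)"
    using cong_solve_coprime_int by blast
  then have "[n * (- l) = - 1] (mod int p)"
    using cong_minus_minus_iff by fastforce
  then show ?thesis
    unfolding neg_inv_def by (rule someI)
qed

text \<open>The numerator of \<open>1/(u+b\<^sub>1) + 1/(u+b\<^sub>2) - 1/(u+b\<^sub>3) - 1/(u+b\<^sub>4)\<close>; its cubic terms cancel.\<close>

definition quad_num :: "int \<Rightarrow> int \<times> int \<times> int \<times> int \<Rightarrow> int" where
  "quad_num u = (\<lambda>(b1,b2,b3,b4). (b3 + b4 - b1 - b2) * u\<^sup>2 + 2 * (b3 * b4 - b1 * b2) * u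
     + ((b1 + b2) * (b3 * b4) - (b3 + b4) * (b1 * b2)))"

text \<open>Multiply the congruence by the product of the four \<open>u + b\<close> and replace each
  \<open>(u + b) * neg_inv p (u + b)\<close> by -1. This direction suffices for an upper bound on
  the number of quadruples.\<close>

lemma neg_inv_sum_imp_quad_num:
  assumes p: "prime p"
    and "\<not> int p dvd u + b1" "\<not> int p dvd u + b2" "\<not> int p dvd u + b3" "\<not> int p dvd u + b4"
    and "[neg_inv p (u + b1) + neg_inv p (u + b2) = neg_inv p (u + b3) + neg_inv p (u + b4)] (mod int p)"
  shows "int p dvd quad_num u (b1, b2, b3, b4)"
proof -
  define x where "x b = u + b" for b
  define l where "l b = neg_inv p (u + b)" for b
  have d: "int p dvd x b * l b + 1" if "b \<in> {b1, b2, b3, b4}" for b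
    using neg_inv[OF p, of "u + b"] that assms(2-5) by (auto simp: x_def l_def cong_iff_dvd_diff)
  have "int p dvd x b1 * x b2 * x b3 * x b4 * (l b1 + l b2 - (l b3 + l b4))"
    using assms(6) unfolding l_def cong_iff_dvd_diff by (rule dvd_mult)
  moreover have "int p dvd (x b1 * l b1 + 1) * (x b2 * x b3 * x b4) + (x b2 * l b2 + 1) * (x b1 * x b3 * x b4)
     - ((x b3 * l b3 + 1) * (x b1 * x b2 * x b4) + (x b4 * l b4 + 1) * (x b1 * x b2 * x b3))"
    by (intro dvd_diff dvd_add dvd_mult2 d) auto
  ultimately have "int p dvd (x b1 * l b1 + 1) * (x b2 * x b3 * x b4) + (x b2 * l b2 + 1) * (x b1 * x b3 * x b4)
     - ((x b3 * l b3 + 1) * (x b1 * x b2 * x b4) + (x b4 * l b4 + 1) * (x b1 * x b2 * x b3))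
     - x b1 * x b2 * x b3 * x b4 * (l b1 + l b2 - (l b3 + l b4))"
    by (rule dvd_diff[rotated])
  also have "\<dots> = quad_num u (b1, b2, b3, b4)"
    unfolding x_def quad_num_def case_prod_conv by (simp add: algebra_simps power2_eq_square)
  finally show ?thesis .
qed

text \<open>For shifts up to the square root of p, the congruences that make the first two
  coefficients vanish are equalities of integers. Equal sums and equal products force {b1, b2} =
  {b3, b4}, so a nontrivial quadruple gives a nonzero polynomial modulo p.\<close>

lemma quad_num_zeros_card:
  assumes p: "prime p" "odd p" and B: "B\<^sup>2 \<le> int p"
    and b: "b1 \<in> {1..B}" "b2 \<in> {1..B}" "b3 \<in> {1..B}" "b4 \<in> {1..B}"
    and nontriv: "\<not> (b1 = b3 \<and> b2 = b4 \<or> b1 = b4 \<and> b2 = b3)"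
  shows "card {u \<in> {0..<int p}. int p dvd quad_num u (b1, b2, b3, b4)} \<le> 2"
  unfolding quad_num_def case_prod_conv
proof (rule quadratic_cong_card_le_2)
  show "prime (int p)"
    using p by simp
  show "\<not> (int p dvd b3 + b4 - b1 - b2 \<and> int p dvd 2 * (b3 * b4 - b1 * b2)
      \<and> int p dvd (b1 + b2) * (b3 * b4) - (b3 + b4) * (b1 * b2))"
  proof (intro notI, elim conjE)
    assume d1: "int p dvd b3 + b4 - b1 - b2" and d2: "int p dvd 2 * (b3 * b4 - b1 * b2)"
    have zero: "z = 0" if "int p dvd z" "\<bar>z\<bar> < int p" for z
      using that by (metis dvd_imp_le_int leD abs_of_nat)
    \<comment> \<open>The two sums differ by at most 2 (B - 1), and this is below p because 2 B - 1
      is at most B^2.\<close>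
    have "0 \<le> (B - 1)\<^sup>2"
      by simp
    then have "2 * B - 1 \<le> int p"
      using B by (simp add: power2_eq_square algebra_simps)
    then have s: "b3 + b4 - b1 - b2 = 0"
      using b by (intro zero d1) auto
    have "coprime (int p) 2"
      using p(2) by simp
    then have d3: "int p dvd b3 * b4 - b1 * b2"
      using d2 coprime_dvd_mult_right_iff by blast
    have bd: "1 \<le> x * y \<and> x * y \<le> int p" if "x \<in> {1..B}" "y \<in> {1..B}" for x y
    proof -
      have "x * y \<le> B * B"
        using that by (intro mult_mono) auto
      moreover have "1 * 1 \<le> x * y"
        using that by (intro mult_mono) auto
      ultimately show ?thesis
        using B by (simp add: power2_eq_square)
    qed
    have t: "b3 * b4 - b1 * b2 = 0"
      using bd[OF b(1,2)] bd[OF b(3,4)] by (intro zero d3) auto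
    \<comment> \<open>The polynomial (X - b3)(X - b4) at X = b1, expressed through the differences
      of its coefficients from those of (X - b1)(X - b2).\<close>
    have "(b1 - b3) * (b1 - b4) = (b3 * b4 - b1 * b2) - b1 * (b3 + b4 - b1 - b2)"
      by (simp add: algebra_simps)
    then have "b1 = b3 \<or> b1 = b4"
      unfolding s t by simp
    then show False
      using s nontriv by auto
  qed
qed

lemma card_trivial_quadruples:
  fixes S :: "'a set"
  assumes "finite S"
  shows "card {(b1,b2,b3,b4) \<in> S \<times> S \<times> S \<times> S. b1 = b3 \<and> b2 = b4 \<or> b1 = b4 \<and> b2 = b3} \<le> 2 * (card S)\<^sup>2"
proof -
  have "{(b1,b2,b3,b4) \<in> S \<times> S \<times> S \<times> S. b1 = b3 \<and> b2 = b4 \<or> b1 = b4 \<and> b2 = b3}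
     \<subseteq> (\<lambda>(x,y). (x,y,x,y)) ` (S \<times> S) \<union> (\<lambda>(x,y). (x,y,y,x)) ` (S \<times> S)"
    by auto
  then have "card {(b1,b2,b3,b4) \<in> S \<times> S \<times> S \<times> S. b1 = b3 \<and> b2 = b4 \<or> b1 = b4 \<and> b2 = b3}
     \<le> card ((\<lambda>(x,y). (x,y,x,y)) ` (S \<times> S) \<union> (\<lambda>(x,y). (x,y,y,x)) ` (S \<times> S))"
    using assms by (intro card_mono) auto
  also have "\<dots> \<le> card ((\<lambda>(x,y). (x,y,x,y)) ` (S \<times> S)) + card ((\<lambda>(x,y). (x,y,y,x)) ` (S \<times> S))"
    by (rule card_Un_le)
  also have "\<dots> \<le> card (S \<times> S) + card (S \<times> S)"
    using assms by (intro add_mono card_image_le) auto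
  finally show ?thesis
    by (simp add: card_cartesian_product power2_eq_square)
qed

text \<open>Double counting: each of the at most 2 B^2 trivial quadruples may vanish for all p
  values of u, each of the at most B^4 others for at most two.\<close>

lemma sum_card_quad_num:
  assumes p: "prime p" "odd p" and B: "int B ^ 2 \<le> int p"
  defines "S \<equiv> {1..int B}"
  shows "(\<Sum>u = 0..<int p. card {q \<in> S \<times> S \<times> S \<times> S. int p dvd quad_num u q}) \<le> 2 * B\<^sup>2 * p + 2 * B ^ 4"
proof -
  define Q where "Q = S \<times> S \<times> S \<times> S"
  define Z where "Z = {(b1,b2,b3,b4) \<in> S \<times> S \<times> S \<times> S. b1 = b3 \<and> b2 = b4 \<or> b1 = b4 \<and> b2 = b3}"
  have fin: "finite S" "finite Q" "card S = B"
    by (simp_all add: S_def Q_def)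
  have ZQ: "Z \<subseteq> Q"
    by (auto simp: Z_def Q_def)
  then have finZ: "finite Z"
    using fin finite_subset by blast
  have cQ: "card Q = B ^ 4"
    by (simp add: Q_def card_cartesian_product fin eval_nat_numeral)
  have "(\<Sum>u = 0..<int p. card {q \<in> Q. int p dvd quad_num u q})
      = (\<Sum>q\<in>Q. card {u \<in> {0..<int p}. int p dvd quad_num u q})"
    using fin by (intro sum_multicount_gen) auto
  also have "\<dots> = (\<Sum>q\<in>Z. card {u \<in> {0..<int p}. int p dvd quad_num u q})
      + (\<Sum>q\<in>Q - Z. card {u \<in> {0..<int p}. int p dvd quad_num u q})"
    using sum.subset_diff[OF ZQ fin(2)] by (simp add: add.commute)
  also have "\<dots> \<le> (\<Sum>q\<in>Z. p) + (\<Sum>q\<in>Q - Z. 2)"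
  proof (intro add_mono sum_mono)
    fix q
    have "card {u \<in> {0..<int p}. int p dvd quad_num u q} \<le> card {0..<int p}"
      by (intro card_mono) auto
    then show "card {u \<in> {0..<int p}. int p dvd quad_num u q} \<le> p"
      by simp
  next
    fix q assume q: "q \<in> Q - Z"
    obtain b1 b2 b3 b4 where q': "q = (b1, b2, b3, b4)"
      by (metis surj_pair)
    show "card {u \<in> {0..<int p}. int p dvd quad_num u q} \<le> 2"
      unfolding q' by (rule quad_num_zeros_card[OF p B]) (use q in \<open>auto simp: q' Q_def Z_def S_def\<close>)
  qed
  also have "\<dots> \<le> 2 * B\<^sup>2 * p + 2 * B ^ 4"
  proof -
    have "card Z \<le> 2 * B\<^sup>2"
      using card_trivial_quadruples[OF fin(1)] unfolding Z_def fin(3) .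
    moreover have "card (Q - Z) \<le> B ^ 4"
      using card_mono[of Q "Q - Z"] fin cQ by auto
    ultimately show ?thesis
      by (simp add: add_mono mult_mono)
  qed
  finally show ?thesis
    unfolding Q_def .
qed

text \<open>For B^2 at most p the bound is at most 4 B^2 p^2. With p^2 residues x, the mean fourth
  power is O(B^2), which is square-root cancellation on average.\<close>

lemma chi_fourth_moment:
  assumes p: "prime p" "odd p" and B: "int B ^ 2 \<le> int p" and c: "\<not> int p dvd c"
  shows "(\<Sum>x = 0..<int p ^ 2. norm (\<Sum>b = 1..int B. chi p c (x + b)) ^ 4)
    \<le> real p * (2 * real B ^ 2 * real p + 2 * real B ^ 4)"
proof -
  define S where "S = {1..int B}"
  define T where "T x = (\<Sum>b\<in>S. chi p c (x + b))" for x
  have p0: "p > 0" "prime (int p)"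
    using p prime_gt_0_nat by auto
  have "(\<Sum>x = 0..<int p ^ 2. norm (T x) ^ 4)
      = (\<Sum>(u,v)\<in>{0..<int p} \<times> {0..<int p}. norm (T (u + int p * v)) ^ 4)"
  \<comment> \<open>Division by p writes each residue modulo p^2 uniquely as u + p v with 0 \<le> u,
    v < p.\<close>
  proof (rule sum.reindex_bij_witness[of _ "\<lambda>(u,v). u + int p * v" "\<lambda>x. (x mod int p, x div int p)"])
    fix x assume "x \<in> {0..<int p ^ 2}"
    then have x: "0 \<le> x" "x < int p * int p"
      by (auto simp: power2_eq_square)
    have "x div int p * int p \<le> x"
      using div_mult_mod_eq[of x "int p"] pos_mod_sign[of "int p" x] p0 by linarith
    then have "x div int p < int p"
      using x by (metis le_less_trans mult_less_cancel_right of_nat_0_le_iff order.asym)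
    then show "(x mod int p, x div int p) \<in> {0..<int p} \<times> {0..<int p}"
      using p0 x by (simp add: pos_imp_zdiv_nonneg_iff)
  next
    fix w assume "w \<in> {0..<int p} \<times> {0..<int p}"
    then obtain u v where w: "w = (u, v)" "0 \<le> u" "u < int p" "0 \<le> v" "v < int p"
      by auto
    have "int p * v \<le> int p * (int p - 1)"
      using w by (intro mult_left_mono) auto
    then show "(case w of (u, v) \<Rightarrow> u + int p * v) \<in> {0..<int p ^ 2}"
      using w by (simp add: power2_eq_square algebra_simps)
  qed (use p0 in \<open>auto simp: mult.commute\<close>)
  also have "\<dots> = (\<Sum>u = 0..<int p. \<Sum>v = 0..<int p. norm (T (u + int p * v)) ^ 4)"
    by (simp add: sum.cartesian_product)
  also have "\<dots> \<le> (\<Sum>u = 0..<int p. real p * real (card {q \<in> S \<times> S \<times> S \<times> S. int p dvd quad_num u q}))"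
  proof (rule sum_mono)
    fix u
    \<comment> \<open>Where p divides u + b, chi vanishes for every v and \<open>neg_inv\<close> has
      no meaning; these b are removed so that \<open>chi_shift\<close> applies to all the
      others.\<close>
    define Su where "Su = {b \<in> S. \<not> int p dvd u + b}"
    have "finite S"
      by (simp add: S_def)
    then have fin: "finite Su" "finite S"
      by (simp_all add: Su_def)
    have "T (u + int p * v) = (\<Sum>b\<in>Su. chi p c (u + b) * ee p (v * (c * neg_inv p (u + b))))" for v
    proof -
      have "T (u + int p * v) = (\<Sum>b\<in>Su. chi p c (u + b + int p * v))"
        unfolding T_def Su_def using fin(2)
        by (intro sum.mono_neutral_cong_right)
          (auto simp: chi_def dvd_add_left_iff add_ac simp flip: add.assoc)
      also have "\<dots> = (\<Sum>b\<in>Su. chi p c (u + b) * ee p (v * (c * neg_inv p (u + b))))"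
        by (intro sum.cong refl chi_shift neg_inv p) (auto simp: Su_def)
      finally show ?thesis .
    qed
    then have "(\<Sum>v = 0..<int p. norm (T (u + int p * v)) ^ 4)
        \<le> real p * real (card {(b1,b2,b3,b4) \<in> Su \<times> Su \<times> Su \<times> Su.
            [c * neg_inv p (u + b1) + c * neg_inv p (u + b2)
           = c * neg_inv p (u + b3) + c * neg_inv p (u + b4)] (mod int p)})"
      using fourth_moment_le_count[OF p0(1) fin(1), of "\<lambda>b. chi p c (u + b)" "\<lambda>b. c * neg_inv p (u + b)"]
      by (simp add: norm_chi_le)
    also have "card {(b1,b2,b3,b4) \<in> Su \<times> Su \<times> Su \<times> Su.
            [c * neg_inv p (u + b1) + c * neg_inv p (u + b2)
           = c * neg_inv p (u + b3) + c * neg_inv p (u + b4)] (mod int p)}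
        \<le> card {q \<in> S \<times> S \<times> S \<times> S. int p dvd quad_num u q}"
    proof (rule card_mono)
      show "finite {q \<in> S \<times> S \<times> S \<times> S. int p dvd quad_num u q}"
        using fin by simp
      show "{(b1,b2,b3,b4) \<in> Su \<times> Su \<times> Su \<times> Su.
            [c * neg_inv p (u + b1) + c * neg_inv p (u + b2)
           = c * neg_inv p (u + b3) + c * neg_inv p (u + b4)] (mod int p)}
          \<subseteq> {q \<in> S \<times> S \<times> S \<times> S. int p dvd quad_num u q}"
      proof (rule subsetI)
        fix q
        assume q: "q \<in> {(b1,b2,b3,b4) \<in> Su \<times> Su \<times> Su \<times> Su.
            [c * neg_inv p (u + b1) + c * neg_inv p (u + b2)
           = c * neg_inv p (u + b3) + c * neg_inv p (u + b4)] (mod int p)}"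
        obtain b1 b2 b3 b4 where q': "q = (b1, b2, b3, b4)"
          by (metis surj_pair)
        have b: "b1 \<in> Su" "b2 \<in> Su" "b3 \<in> Su" "b4 \<in> Su"
          and "[c * neg_inv p (u + b1) + c * neg_inv p (u + b2)
           = c * neg_inv p (u + b3) + c * neg_inv p (u + b4)] (mod int p)"
          using q unfolding q' by simp_all
        \<comment> \<open>The frequency factor c is a unit modulo p and cancels.\<close>
        then have "[neg_inv p (u + b1) + neg_inv p (u + b2)
           = neg_inv p (u + b3) + neg_inv p (u + b4)] (mod int p)"
          by (simp add: cong_cancel_prime[OF p0(2) c] distrib_left)
        then have "int p dvd quad_num u (b1, b2, b3, b4)"
          using b neg_inv_sum_imp_quad_num[OF p(1), of u b1 b2 b3 b4] by (simp add: Su_def)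
        then show "q \<in> {q \<in> S \<times> S \<times> S \<times> S. int p dvd quad_num u q}"
          using b unfolding q' by (simp add: Su_def)
      qed
    qed
    finally show "(\<Sum>v = 0..<int p. norm (T (u + int p * v)) ^ 4)
      \<le> real p * real (card {q \<in> S \<times> S \<times> S \<times> S. int p dvd quad_num u q})"
      by (simp add: mult_left_mono)
  qed
  also have "\<dots> = real p * real (\<Sum>u = 0..<int p. card {q \<in> S \<times> S \<times> S \<times> S. int p dvd quad_num u q})"
    by (simp add: sum_distrib_left)
  also have "\<dots> \<le> real p * real (2 * B\<^sup>2 * p + 2 * B ^ 4)"
    using sum_card_quad_num[OF p B] unfolding S_def by (intro mult_left_mono of_nat_mono) auto
  finally show ?thesis
    by (simp add: T_def S_def)
qed

section \<open>The Burgess bound\<close>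

lemma sum_inverse_le_ln:
  assumes "n \<ge> 1"
  shows "(\<Sum>k = 1..n. 1 / real k) \<le> 1 + ln (real n)"
  using assms
proof (induction n rule: dec_induct)
  case (step n)
  have "ln (real n / real (Suc n)) \<le> real n / real (Suc n) - 1"
    using step by (intro ln_le_minus_one) simp
  also have "\<dots> = - (1 / real (Suc n))"
    by (simp add: field_simps)
  finally have "1 / real (Suc n) \<le> ln (real (Suc n)) - ln (real n)"
    using step by (simp add: ln_div)
  then show ?case
    using step by simp
qed simp

text \<open>Cauchy-Schwarz twice, the second time against the fibre sizes of \<open>\<phi>\<close>.\<close>

lemma holder_via_coincidences:
  fixes f :: "'b \<Rightarrow> real"
  assumes fin: "finite X" "finite Y" and im: "\<phi> ` X \<subseteq> Y"
  shows "(\<Sum>x\<in>X. f (\<phi> x)) ^ 4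
    \<le> real (card X) ^ 2 * real (card {(x, x') \<in> X \<times> X. \<phi> x = \<phi> x'}) * (\<Sum>y\<in>Y. f y ^ 4)"
proof -
  define nu where "nu y = card {x\<in>X. \<phi> x = y}" for y
  have "(\<Sum>x\<in>X. (f (\<phi> x))\<^sup>2) = (\<Sum>y\<in>Y. \<Sum>x | x \<in> X \<and> \<phi> x = y. (f (\<phi> x))\<^sup>2)"
    by (rule sum.group[OF fin im, symmetric])
  also have "\<dots> = (\<Sum>y\<in>Y. real (nu y) * (f y)\<^sup>2)"
    by (intro sum.cong) (auto simp: nu_def)
  finally have eq: "(\<Sum>x\<in>X. (f (\<phi> x))\<^sup>2) = (\<Sum>y\<in>Y. real (nu y) * (f y)\<^sup>2)" .
  have "{(x, x') \<in> X \<times> X. \<phi> x = \<phi> x'} = (\<Union>y\<in>Y. {x\<in>X. \<phi> x = y} \<times> {x\<in>X. \<phi> x = y})"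
    using im by auto
  then have "card {(x, x') \<in> X \<times> X. \<phi> x = \<phi> x'} = card (\<Union>y\<in>Y. {x\<in>X. \<phi> x = y} \<times> {x\<in>X. \<phi> x = y})"
    by (rule arg_cong)
  also have "\<dots> = (\<Sum>y\<in>Y. card ({x\<in>X. \<phi> x = y} \<times> {x\<in>X. \<phi> x = y}))"
    using fin by (intro card_UN_disjoint) auto
  also have "\<dots> = (\<Sum>y\<in>Y. (nu y)\<^sup>2)"
    by (simp add: nu_def card_cartesian_product power2_eq_square)
  finally have card_eq: "real (card {(x, x') \<in> X \<times> X. \<phi> x = \<phi> x'}) = (\<Sum>y\<in>Y. (real (nu y))\<^sup>2)"
    by simp
  have "(\<Sum>x\<in>X. f (\<phi> x)) ^ 4 = ((\<Sum>x\<in>X. f (\<phi> x))\<^sup>2)\<^sup>2"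
    by simp
  also have "\<dots> \<le> ((\<Sum>x\<in>X. (f (\<phi> x))\<^sup>2) * card X)\<^sup>2"
    by (intro power_mono sum_squared_le_sum_of_squares) simp
  also have "\<dots> = real (card X) ^ 2 * (\<Sum>y\<in>Y. real (nu y) * (f y)\<^sup>2)\<^sup>2"
    by (simp add: eq power_mult_distrib mult.commute)
  also have "\<dots> \<le> real (card X) ^ 2 * ((\<Sum>y\<in>Y. (real (nu y))\<^sup>2) * (\<Sum>y\<in>Y. ((f y)\<^sup>2)\<^sup>2))"
    by (intro mult_left_mono Cauchy_Schwarz_ineq_sum) simp
  finally show ?thesis
    unfolding card_eq by (simp add: mult.assoc flip: power_mult)
qed

text \<open>Each d has at most M/d multiples up to M, and the harmonic sum supplies the
  logarithm.\<close>

lemma card_divisor_pairs_le: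
  assumes "M \<ge> 1"
  shows "real (card {(d, m). d \<in> {1..int M} \<and> m \<in> {1..int M} \<and> d dvd m}) \<le> real M * (1 + ln (real M))"
proof -
  have "card {m \<in> {1..int M}. int d dvd m} \<le> M div d" if d: "d \<in> {1..M}" for d
  proof -
    have "{m \<in> {1..int M}. int d dvd m} \<subseteq> (\<lambda>k. int d * int k) ` {1..M div d}"
    proof
      fix m assume "m \<in> {m \<in> {1..int M}. int d dvd m}"
      then obtain k where k: "m = int d * k" "1 \<le> m" "m \<le> int M"
        by auto
      then have "k > 0"
        using d by (metis atLeastAtMost_iff less_le_trans linorder_not_less mult_nonneg_nonpos of_nat_0_le_iff zero_less_one)
      moreover have "k \<le> int (M div d)"
        using k d by (metis atLeastAtMost_iff div_mult_self1_is_m less_le_trans mult.commute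
            nonzero_mult_div_cancel_left of_nat_0_less_iff of_nat_div zdiv_mono1 zero_less_one less_irrefl)
      ultimately show "m \<in> (\<lambda>k. int d * int k) ` {1..M div d}"
        by (intro image_eqI[of _ _ "nat k"]) (auto simp: k)
    qed
    then have "card {m \<in> {1..int M}. int d dvd m} \<le> card ((\<lambda>k. int d * int k) ` {1..M div d})"
      by (intro card_mono) auto
    also have "\<dots> \<le> card {1..M div d}"
      by (intro card_image_le) simp
    finally show ?thesis
      by simp
  qed
  then have le: "real (card {m \<in> {1..int M}. int d dvd m}) \<le> real M * (1 / real d)" if "d \<in> {1..M}" for d
    using that of_nat_div_le_of_nat[of M d, where 'a = real] of_nat_mono[of _ "M div d", where 'a = real]
    by fastforce
  have "{(d, m). d \<in> {1..int M} \<and> m \<in> {1..int M} \<and> d dvd m}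
      = (SIGMA d:{1..int M}. {m \<in> {1..int M}. d dvd m})"
    by auto
  then have "card {(d, m). d \<in> {1..int M} \<and> m \<in> {1..int M} \<and> d dvd m}
      = card (SIGMA d:{1..int M}. {m \<in> {1..int M}. d dvd m})"
    by (rule arg_cong)
  also have "\<dots> = (\<Sum>d\<in>{1..int M}. card {m \<in> {1..int M}. d dvd m})"
    by (rule card_SigmaI) (simp, rule ballI, rule finite_subset[of _ "{1..int M}"], auto)
  also have "\<dots> = (\<Sum>d\<in>{1..M}. card {m \<in> {1..int M}. int d dvd m})"
    by (rule sum.reindex_bij_witness[of _ int nat]) auto
  finally have "real (card {(d, m). d \<in> {1..int M} \<and> m \<in> {1..int M} \<and> d dvd m})
      = (\<Sum>d\<in>{1..M}. real (card {m \<in> {1..int M}. int d dvd m}))"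
    by simp
  also have "\<dots> \<le> (\<Sum>d\<in>{1..M}. real M * (1 / real d))"
    by (intro sum_mono le)
  also have "\<dots> = real M * (\<Sum>d = 1..M. 1 / real d)"
    by (simp add: sum_distrib_left)
  also have "\<dots> \<le> real M * (1 + ln (real M))"
    by (intro mult_left_mono sum_inverse_le_ln assms) simp
  finally show ?thesis .
qed

text \<open>A solution of \<open>n a' = n' a\<close> is determined by \<open>a\<close>, \<open>n'\<close> and the divisors
  \<open>gcd a a'\<close> of \<open>a\<close> and \<open>gcd n n'\<close> of \<open>n'\<close>.\<close>

lemma card_proportional_le:
  assumes "A \<ge> 1" "N \<ge> 1"
  defines "X \<equiv> {1..int A} \<times> {1..int N}"
  shows "real (card {((a, n), (a', n')) \<in> X \<times> X. n * a' = n' * a})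
    \<le> real A * (1 + ln (real A)) * (real N * (1 + ln (real N)))"
proof -
  define E where "E = {((a, n), (a', n')) \<in> X \<times> X. n * a' = n' * a}"
  define D where "D M = {(d, m). d \<in> {1..int M} \<and> m \<in> {1..int M} \<and> d dvd m}" for M
  define \<psi> where "\<psi> = (\<lambda>((a::int, n::int), (a', n')). ((gcd a a', a), (gcd n n', n')))"
  have finD: "finite (D M)" for M
    by (rule finite_subset[of _ "{1..int M} \<times> {1..int M}"]) (auto simp: D_def)
  \<comment> \<open>With a, n' and the two gcds known, the first relation determines a' and the
    second determines n. Both follow by moving a factor into a gcd and applying n a' = n' a
    there.\<close>
  have key: "gcd n n' * a' = n' * gcd a a'" "n * gcd a a' = gcd n n' * a"
    if "n * a' = n' * a" "a > 0" "a' > 0" "n > 0" "n' > 0" for a n a' n' :: int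
  proof -
    have gm: "gcd (x * z) (y * z) = gcd x y * z" if "z > 0" for x y z :: int
      using gcd_mult_distrib_int[of z x y] that by (simp add: mult.commute)
    have "gcd n n' * a' = gcd (n * a') (n' * a')"
      by (rule gm[of a' n n', symmetric]) (rule that)
    also have "\<dots> = gcd (a * n') (a' * n')"
      unfolding that(1) by (simp only: mult.commute)
    also have "\<dots> = n' * gcd a a'"
      using gm[of n' a a'] that by simp
    finally show "gcd n n' * a' = n' * gcd a a'" .
    have "n * gcd a a' = gcd (a * n) (a' * n)"
      using gm[of n a a'] that by simp
    also have "\<dots> = gcd (n * a) (n' * a)"
      unfolding that(1)[symmetric] by (simp only: mult.commute)
    also have "\<dots> = gcd n n' * a"
      using gm[of a n n'] that by simp
    finally show "n * gcd a a' = gcd n n' * a" .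
  qed
  have inj: "inj_on \<psi> E"
  proof (rule inj_onI)
    fix s t assume s: "s \<in> E" and t: "t \<in> E" and eq: "\<psi> s = \<psi> t"
    obtain a n a' n' where s': "s = ((a, n), (a', n'))"
      by (metis surj_pair)
    obtain b m b' m' where t': "t = ((b, m), (b', m'))"
      by (metis surj_pair)
    have pos: "a > 0" "n > 0" "a' > 0" "n' > 0" "b > 0" "m > 0" "b' > 0" "m' > 0"
      and st: "n * a' = n' * a" "m * b' = m' * b"
      using s t by (auto simp: s' t' E_def X_def)
    have e: "b = a" "m' = n'" "gcd a b' = gcd a a'" "gcd m n' = gcd n n'"
      using eq by (auto simp: s' t' \<psi>_def)
    have "gcd n n' * a' = gcd n n' * b'" "n * gcd a a' = m * gcd a a'"
      using key[OF st(1)] key[OF st(2)] pos by (simp_all add: e)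
    moreover have "gcd n n' \<noteq> 0" "gcd a a' \<noteq> 0"
      using pos by simp_all
    ultimately have "a' = b'" "n = m"
      by (metis mult_cancel_left, metis mult_cancel_right)
    then show "s = t"
      using e(1,2) by (simp add: s' t')
  qed
  have "\<psi> ` E \<subseteq> D A \<times> D N"
  proof
    fix w assume "w \<in> \<psi> ` E"
    then obtain a n a' n' where w: "w = \<psi> ((a, n), (a', n'))" and "((a, n), (a', n')) \<in> E"
      by auto
    then have b: "a \<in> {1..int A}" "a' \<in> {1..int A}" "n \<in> {1..int N}" "n' \<in> {1..int N}"
      by (auto simp: E_def X_def)
    have "gcd a a' \<le> a" "gcd n n' \<le> n'" "gcd a a' \<ge> 1" "gcd n n' \<ge> 1"
      using b by (auto intro!: zdvd_imp_le simp: int_one_le_iff_zero_less)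
    then show "w \<in> D A \<times> D N"
      using b by (auto simp: w \<psi>_def D_def)
  qed
  then have "card E \<le> card (D A \<times> D N)"
    using finD by (intro card_inj_on_le[OF inj]) auto
  then have "real (card E) \<le> real (card (D A)) * real (card (D N))"
    by (simp add: card_cartesian_product flip: of_nat_mult)
  also have "\<dots> \<le> real A * (1 + ln (real A)) * (real N * (1 + ln (real N)))"
    using assms(1,2) unfolding D_def
    by (intro mult_mono card_divisor_pairs_le) auto
  finally show ?thesis
    by (simp add: E_def)
qed

text \<open>As A < p, every a is a unit modulo p^2 and n/a makes sense there. The factors are (A
  N)^2 from the number of pairs, A N with two logarithms from the coincidences, and at most 4 p^3
  from the fourth moment when B^2 is at most p.\<close>

lemma burgess_bound:
  assumes p: "prime p" "odd p" and B: "int B ^ 2 \<le> int p" and c: "\<not> int p dvd c"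
    and A: "A \<ge> 1" "A < p" and N: "N \<ge> 1" "N < p"
  shows "(\<Sum>(a, n)\<in>{1..int A} \<times> {1..int N}. norm (\<Sum>b = 1..int B. chi p c (n + a * b))) ^ 4
    \<le> 4 * real A ^ 3 * real p ^ 6 * (1 + ln (real p)) ^ 2"
proof -
  define X where "X = {1..int A} \<times> {1..int N}"
  define Y where "Y = {0..<int p ^ 2}"
  define T where "T x = norm (\<Sum>b = 1..int B. chi p c (x + b))" for x
  have p0: "p > 0" "prime (int p)" "1 \<le> p"
    using p prime_gt_0_nat by (auto simp: Suc_le_eq)
  define r where "r a = (SOME l. [a * l = 1] (mod int p ^ 2))" for a
  have r: "[a * r a = 1] (mod int p ^ 2)" if "a \<in> {1..int A}" for a
  proof -
    have "\<not> int p dvd a"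
      using that A zdvd_not_zless[of a "int p"] by auto
    then have "coprime a (int p ^ 2)"
      using p0(2) by (metis coprime_commute coprime_power_right_iff prime_imp_coprime)
    then show ?thesis
      unfolding r_def by (rule someI_ex[OF cong_solve_coprime_int])
  qed
  define \<phi> where "\<phi> = (\<lambda>(a, n). (n * r a) mod int p ^ 2)"
  have phi: "[a * \<phi> (a, n) = n] (mod int p ^ 2)" if "a \<in> {1..int A}" for a n
  proof -
    have "[a * \<phi> (a, n) = a * (n * r a)] (mod int p ^ 2)"
      by (simp add: \<phi>_def cong_scalar_left)
    also have "a * (n * r a) = n * (a * r a)"
      by simp
    also have "[n * (a * r a) = n * 1] (mod int p ^ 2)"
      by (intro cong_scalar_left r that)
    finally show ?thesis
      by simp
  qed
  have le: "norm (\<Sum>b = 1..int B. chi p c (n + a * b)) \<le> T (\<phi> (a, n))" if "a \<in> {1..int A}" for a n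
  proof -
    have "chi p c (n + a * b) = chi p c a * chi p c (\<phi> (a, n) + b)" for b
    proof -
      have "[n + a * b = a * \<phi> (a, n) + a * b] (mod int p ^ 2)"
        by (intro cong_add cong_refl cong_sym[OF phi] that)
      then have "chi p c (n + a * b) = chi p c (a * (\<phi> (a, n) + b))"
        unfolding distrib_left by (rule chi_cong[OF p(1)])
      then show ?thesis
        by (simp add: chi_mult[OF p(1)])
    qed
    then have "(\<Sum>b = 1..int B. chi p c (n + a * b)) = chi p c a * (\<Sum>b = 1..int B. chi p c (\<phi> (a, n) + b))"
      by (simp add: sum_distrib_left)
    then show ?thesis
      by (simp add: T_def norm_mult norm_chi_le mult_left_le_one_le)
  qed
  have "(\<Sum>(a, n)\<in>X. norm (\<Sum>b = 1..int B. chi p c (n + a * b))) \<le> (\<Sum>x\<in>X. T (\<phi> x))"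
    by (intro sum_mono) (auto simp: X_def intro!: le)
  then have "(\<Sum>(a, n)\<in>X. norm (\<Sum>b = 1..int B. chi p c (n + a * b))) ^ 4 \<le> (\<Sum>x\<in>X. T (\<phi> x)) ^ 4"
    by (intro power_mono) (auto intro!: sum_nonneg)
  also have "\<dots> \<le> real (card X) ^ 2 * real (card {(x, x') \<in> X \<times> X. \<phi> x = \<phi> x'}) * (\<Sum>y\<in>Y. T y ^ 4)"
    using p0 by (intro holder_via_coincidences) (auto simp: X_def Y_def \<phi>_def)
  also have "\<dots> \<le> (real A * real N) ^ 2 * (real A * (1 + ln (real A)) * (real N * (1 + ln (real N))))
      * (real p * (2 * real B ^ 2 * real p + 2 * real B ^ 4))"
  proof (intro mult_mono)
    have finX: "finite X"
      by (simp add: X_def)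
    have "{(x, x') \<in> X \<times> X. \<phi> x = \<phi> x'} \<subseteq> {((a, n), (a', n')) \<in> X \<times> X. n * a' = n' * a}"
    proof
      fix w assume w: "w \<in> {(x, x') \<in> X \<times> X. \<phi> x = \<phi> x'}"
      obtain a n a' n' where w': "w = ((a, n), (a', n'))"
        by (metis surj_pair)
      have b: "a \<in> {1..int A}" "a' \<in> {1..int A}" "n \<in> {1..int N}" "n' \<in> {1..int N}"
        and eq: "\<phi> (a, n) = \<phi> (a', n')"
        using w by (auto simp: w' X_def)
      have "[n * a' = (a * \<phi> (a, n)) * a'] (mod int p ^ 2)"
        by (intro cong_scalar_right cong_sym[OF phi] b)
      also have "(a * \<phi> (a, n)) * a' = (a' * \<phi> (a', n')) * a"
        by (simp add: eq)
      also have "[(a' * \<phi> (a', n')) * a = n' * a] (mod int p ^ 2)"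
        by (intro cong_scalar_right phi b)
      finally have cong: "[n * a' = n' * a] (mod int p ^ 2)" .
      \<comment> \<open>Since A and N are below p, both products are below p^2, and the congruence
        becomes an equality of integers.\<close>
      have bd: "0 \<le> x * y \<and> x * y < int p ^ 2" if "x \<in> {1..int N}" "y \<in> {1..int A}" for x y
        using that A N mult_strict_mono[of x "int p" y "int p"] by (auto simp: power2_eq_square)
      have "n * a' = n' * a"
        using bd b cong by (intro cong_less_imp_eq_int[of _ "int p ^ 2"]) auto
      then show "w \<in> {((a, n), (a', n')) \<in> X \<times> X. n * a' = n' * a}"
        using w by (auto simp: w')
    qed
    then have "card {(x, x') \<in> X \<times> X. \<phi> x = \<phi> x'} \<le> card {((a, n), (a', n')) \<in> X \<times> X. n * a' = n' * a}"
      using finX by (intro card_mono) (auto intro: finite_subset[of _ "X \<times> X"])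
    then show "real (card {(x, x') \<in> X \<times> X. \<phi> x = \<phi> x'}) \<le> real A * (1 + ln (real A)) * (real N * (1 + ln (real N)))"
      using card_proportional_le[OF A(1) N(1)] unfolding X_def by linarith
    show "(\<Sum>y\<in>Y. T y ^ 4) \<le> real p * (2 * real B ^ 2 * real p + 2 * real B ^ 4)"
      using chi_fourth_moment[OF p B c] by (simp add: T_def Y_def)
  qed (use A N in \<open>auto simp: X_def card_cartesian_product T_def intro!: sum_nonneg mult_nonneg_nonneg add_nonneg_nonneg\<close>)
  \<comment> \<open>N and B^2 are replaced by p, and both logarithms by that of p.\<close>
  also have "\<dots> \<le> (real A * real p) ^ 2 * (real A * (1 + ln (real p)) * (real p * (1 + ln (real p))))
      * (real p * (2 * real p * real p + 2 * real p ^ 2))"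
  proof -
    have "real B ^ 2 \<le> real p"
      using B by (metis of_int_le_iff of_int_of_nat_eq of_int_power)
    moreover from this have "(real B ^ 2) ^ 2 \<le> real p ^ 2"
      by (intro power_mono) auto
    ultimately show ?thesis
      using A N p0
      by (intro mult_mono add_mono power_mono) (auto intro!: mult_nonneg_nonneg add_nonneg_nonneg)
  qed
  also have "\<dots> = 4 * real A ^ 3 * real p ^ 6 * (1 + ln (real p)) ^ 2"
    by (simp add: eval_nat_numeral algebra_simps)
  finally show ?thesis
    by (simp add: X_def)
qed

section \<open>Finite Fourier expansion of the distance to a point\<close>

text \<open>The factor 1/p sits in the transform, so inversion is a bare sum and the coefficient at
  0 is the mean of g.\<close>

definition ftransform :: "nat \<Rightarrow> (int \<Rightarrow> real) \<Rightarrow> int \<Rightarrow> complex" where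
  "ftransform p g c = (\<Sum>j = 0..<int p. of_real (g j) * ee p (- (c * j))) / of_nat p"

lemma ftransform_inversion:
  assumes "p > 0" "m \<in> {0..<int p}"
  shows "of_real (g m) = (\<Sum>c = 0..<int p. ftransform p g c * ee p (c * m))"
proof -
  have "(\<Sum>c = 0..<int p. ftransform p g c * ee p (c * m))
      = (\<Sum>c = 0..<int p. \<Sum>j = 0..<int p. of_real (g j) / of_nat p * ee p (c * (m - j)))"
  proof (rule sum.cong[OF refl])
    fix c
    have "ee p (c * (m - j)) = ee p (- (c * j)) * ee p (c * m)" for j
      by (simp add: algebra_simps flip: ee_add)
    then show "ftransform p g c * ee p (c * m)
        = (\<Sum>j = 0..<int p. of_real (g j) / of_nat p * ee p (c * (m - j)))"
      by (simp add: ftransform_def sum_divide_distrib sum_distrib_right mult.assoc)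
  qed
  also have "\<dots> = (\<Sum>j = 0..<int p. of_real (g j) / of_nat p * (\<Sum>c = 0..<int p. ee p (c * (m - j))))"
    by (subst sum.swap) (simp add: sum_distrib_left)
  also have "\<dots> = (\<Sum>j = 0..<int p. if j = m then of_real (g j) else 0)"
  proof (rule sum.cong[OF refl])
    fix j assume j: "j \<in> {0..<int p}"
    have "int p dvd m - j \<longleftrightarrow> j = m"
      using j assms(2) cong_less_imp_eq_int[of m "int p" j] by (auto simp: cong_iff_dvd_diff)
    then show "of_real (g j) / of_nat p * (\<Sum>c = 0..<int p. ee p (c * (m - j))) = (if j = m then of_real (g j) else 0)"
      using assms(1) by (simp add: sum_ee_orthogonality[OF assms(1)])
  qed
  also have "\<dots> = of_real (g m)"
    using assms(2) by simp
  finally show ?thesis ..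
qed

text \<open>Abel summation, kept free of division by 1 - w. It bounds a Fourier coefficient by the
  total variation of G.\<close>

lemma summation_by_parts_geometric:
  fixes w :: "'a::comm_ring_1"
  shows "(\<Sum>j<Suc n. G j * w ^ j) * (1 - w)
    = G 0 - G n * w ^ Suc n + (\<Sum>j<n. (G (Suc j) - G j) * w ^ Suc j)"
proof (induction n)
  case (Suc n)
  let ?R = "\<Sum>j<n. (G (Suc j) - G j) * w ^ Suc j"
  have "(\<Sum>j<Suc (Suc n). G j * w ^ j) * (1 - w)
      = (G 0 - G n * w ^ Suc n + ?R) + G (Suc n) * w ^ Suc n * (1 - w)"
    unfolding sum.lessThan_Suc[of _ "Suc n"] distrib_right Suc.IH ..
  also have "\<dots> = G 0 - G (Suc n) * w ^ Suc (Suc n) + (?R + (G (Suc n) - G n) * w ^ Suc n)"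
    by (simp add: algebra_simps)
  finally show ?case
    by simp
qed (simp add: algebra_simps)

lemma norm_one_minus_cis: "norm (1 - cis (2 * x)) = 2 * \<bar>sin x\<bar>"
proof -
  have "(norm (1 - cis (2 * x)))\<^sup>2 = (1 - cos (2 * x))\<^sup>2 + (sin (2 * x))\<^sup>2"
    by (simp add: cmod_power2)
  also have "\<dots> = (2 * (sin x)\<^sup>2)\<^sup>2 + (2 * sin x * cos x)\<^sup>2"
    by (simp add: cos_double_sin sin_double)
  also have "\<dots> = (2 * sin x)\<^sup>2 * ((sin x)\<^sup>2 + (cos x)\<^sup>2)"
    by (simp only: power_mult_distrib distrib_left power2_eq_square) (simp add: mult_ac)
  also have "\<dots> = (2 * \<bar>sin x\<bar>)\<^sup>2"
    by simp
  finally show ?thesis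
    by (rule power2_eq_imp_eq) auto
qed

text \<open>From sin x \<ge> x - x^3/6 and x^2 \<le> 3 on this interval. The constant is weaker than
  in Jordan's inequality but suffices.\<close>

lemma sin_ge_half:
  fixes x :: real
  assumes "0 \<le> x" "x \<le> pi / 2"
  shows "x / 2 \<le> sin x"
proof -
  have "\<bar>sin x - x\<bar> \<le> inverse (fact 3) * \<bar>x\<bar> ^ 3"
    using Maclaurin_sin_bound[of x 3] by (simp add: eval_nat_numeral sin_coeff_def)
  also have "\<dots> = x ^ 3 / 6"
    using assms by (simp add: fact_numeral)
  finally have "x - x ^ 3 / 6 \<le> sin x"
    by linarith
  moreover have "x ^ 3 \<le> x * 3"
  proof -
    have "x\<^sup>2 \<le> (16 / 10)\<^sup>2"
      using assms pi_less_4 pi_approx by (intro power_mono) auto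
    then have "x\<^sup>2 \<le> 3"
      by (simp add: power2_eq_square)
    then have "x * x\<^sup>2 \<le> x * 3"
      using assms by (intro mult_left_mono)
    then show ?thesis
      by (simp add: power3_eq_cube power2_eq_square mult.assoc)
  qed
  ultimately show ?thesis
    by simp
qed

text \<open>The norm is 2 |sin(pi c / p)|, and the sine is at least half the distance from pi c / p
  to the nearer of 0 and pi; finally pi is replaced by 2.\<close>

lemma norm_one_minus_ee_ge:
  assumes "1 \<le> c" "c < int p"
  shows "2 * min (real_of_int c) (real p - real_of_int c) / real p \<le> norm (1 - ee p (- c))"
proof -
  define x where "x = pi * real_of_int c / real p"
  have p: "real p > 0" and c: "real_of_int c < real p" "1 \<le> real_of_int c"
    using assms by simp_all
  have "norm (1 - ee p (- c)) = norm (cnj (1 - ee p (- c)))"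
    by (simp only: complex_mod_cnj)
  also have "\<dots> = norm (1 - cis (2 * x))"
    by (simp add: cnj_ee) (simp add: ee_def x_def mult.assoc)
  also have "\<dots> = 2 * \<bar>sin x\<bar>"
    by (rule norm_one_minus_cis)
  finally have n: "norm (1 - ee p (- c)) = 2 * \<bar>sin x\<bar>" .
  have "min x (pi - x) / 2 \<le> sin x"
  proof (cases "x \<le> pi / 2")
    case True
    have "0 \<le> x"
      using p c by (simp add: x_def)
    then show ?thesis
      using sin_ge_half[of x] True by linarith
  next
    case False
    have "x \<le> pi"
      using p c by (simp add: x_def field_simps)
    then show ?thesis
      using sin_ge_half[of "pi - x"] False by simp
  qed
  moreover have "min x (pi - x) = pi * (min (real_of_int c) (real p - real_of_int c) / real p)"
    using p by (simp add: x_def min_def field_simps)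
  moreover have "2 * (min (real_of_int c) (real p - real_of_int c) / real p) \<le> pi * (min (real_of_int c) (real p - real_of_int c) / real p)"
    using pi_ge_two p c by (intro mult_right_mono) auto
  ultimately show ?thesis
    unfolding n by simp
qed

text \<open>The function takes values in [0, 1] and changes by at most 1/p per step. In Abel
  summation the boundary and the variation therefore contribute at most 1 each, and dividing by |1 -
  w| gives decay like 1/c from both ends.\<close>

lemma norm_ftransform_dist_le:
  assumes r: "r \<in> {0..<int p}" and c: "c \<in> {1..<int p}"
  shows "norm (ftransform p (\<lambda>m. real_of_int \<bar>m - r\<bar> / real p) c)
    \<le> 1 / real_of_int c + 1 / (real p - real_of_int c)"
proof -
  define g where "g m = real_of_int \<bar>m - r\<bar> / real p" for m
  define w where "w = ee p (- c)"
  define G where "G j = complex_of_real (g (int j))" for j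
  define \<mu> where "\<mu> = min (real_of_int c) (real p - real_of_int c)"
  obtain n where n: "p = Suc n"
    using r by (cases p) auto
  have p: "real p > 0" and c': "real_of_int c < real p" "1 \<le> real_of_int c"
    using c by (simp_all add: n)
  have mu: "\<mu> > 0"
    using c' by (simp add: \<mu>_def)
  have "(\<Sum>j = 0..<int p. of_real (g j) * ee p (- (c * j))) = (\<Sum>j<Suc n. G j * w ^ j)"
    by (rule sum.reindex_bij_witness[of _ int nat]) (auto simp: n G_def w_def ee_power mult.commute)
  then have ft: "ftransform p g c = (\<Sum>j<Suc n. G j * w ^ j) / of_nat p"
    by (simp add: ftransform_def)
  have g01: "0 \<le> g m \<and> g m \<le> 1" if "m \<in> {0..<int p}" for m
    using that r p by (auto simp: g_def field_simps)
  have "w ^ p = 1"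
    using ee_multiple[of p "- c"] p by (simp add: w_def ee_power)
  \<comment> \<open>Over a full period the boundary term of the summation by parts is just
    \<open>G 0 - G n\<close>.\<close>
  then have "w ^ Suc n = 1"
    by (simp only: n)
  then have "norm ((\<Sum>j<Suc n. G j * w ^ j) * (1 - w)) \<le> norm (G 0 - G n) + norm (\<Sum>j<n. (G (Suc j) - G j) * w ^ Suc j)"
    unfolding summation_by_parts_geometric by (simp add: norm_triangle_ineq del: power_Suc)
  also have "\<dots> \<le> 1 + (\<Sum>j<n. 1 / real p)"
  proof (rule add_mono)
    have "G 0 - G n = of_real (g 0 - g (int n))"
      by (simp add: G_def)
    moreover have "\<bar>g 0 - g (int n)\<bar> \<le> 1"
      using g01[of 0] g01[of "int n"] by (simp add: n abs_le_iff)
    ultimately show "norm (G 0 - G n) \<le> 1"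
      by (simp only: norm_of_real)
    show "norm (\<Sum>j<n. (G (Suc j) - G j) * w ^ Suc j) \<le> (\<Sum>j<n. 1 / real p)"
    proof (rule sum_norm_le)
      fix j
      have "G (Suc j) - G j = of_real (g (int (Suc j)) - g (int j))"
        by (simp add: G_def)
      moreover have "\<bar>g (int (Suc j)) - g (int j)\<bar> \<le> 1 / real p"
      proof -
        have "g (int (Suc j)) - g (int j) = (real_of_int \<bar>int (Suc j) - r\<bar> - real_of_int \<bar>int j - r\<bar>) / real p"
          by (simp add: g_def diff_divide_distrib)
        moreover have "\<bar>real_of_int \<bar>int (Suc j) - r\<bar> - real_of_int \<bar>int j - r\<bar>\<bar> \<le> 1"
          by linarith
        ultimately show ?thesis
          using p by (simp add: abs_divide divide_right_mono)
      qed
      ultimately show "norm ((G (Suc j) - G j) * w ^ Suc j) \<le> 1 / real p"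
        by (simp only: norm_mult norm_of_real norm_power w_def norm_ee power_one mult_1_right)
    qed
  qed
  also have "\<dots> \<le> 2"
    using p by (simp add: n)
  finally have "norm (\<Sum>j<Suc n. G j * w ^ j) * norm (1 - w) \<le> 2"
    by (simp only: norm_mult)
  moreover have "norm (\<Sum>j<Suc n. G j * w ^ j) * (2 * \<mu> / real p) \<le> norm (\<Sum>j<Suc n. G j * w ^ j) * norm (1 - w)"
    unfolding \<mu>_def w_def using c by (intro mult_left_mono norm_one_minus_ee_ge) auto
  ultimately have "norm (\<Sum>j<Suc n. G j * w ^ j) * (2 * \<mu> / real p) \<le> 2"
    by linarith
  then have "norm (ftransform p g c) \<le> 1 / \<mu>"
    using mu p unfolding ft by (simp add: norm_divide field_simps)
  \<comment> \<open>The reciprocal of the minimum is one of these two terms; their sum is easier to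
    add up over c.\<close>
  also have "\<dots> \<le> 1 / real_of_int c + 1 / (real p - real_of_int c)"
    using c' by (simp add: \<mu>_def min_def)
  finally show ?thesis
    by (simp add: g_def[abs_def])
qed

lemma sum_ftransform_bound:
  assumes "p \<ge> 2"
  shows "(\<Sum>c = 1..<int p. 1 / real_of_int c + 1 / (real p - real_of_int c)) \<le> 2 * (1 + ln (real p))"
proof -
  have "(\<Sum>c = 1..<int p. 1 / real_of_int c) = (\<Sum>k = 1..p - 1. 1 / real k)"
    by (rule sum.reindex_bij_witness[of _ int nat]) auto
  moreover have "(\<Sum>c = 1..<int p. 1 / (real p - real_of_int c)) = (\<Sum>k = 1..p - 1. 1 / real k)"
    by (rule sum.reindex_bij_witness[of _ "\<lambda>k. int p - int k" "\<lambda>c. nat (int p - c)"]) auto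
  moreover have "(\<Sum>k = 1..p - 1. 1 / real k) \<le> 1 + ln (real (p - 1))"
    using assms by (intro sum_inverse_le_ln) auto
  moreover have "ln (real (p - 1)) \<le> ln (real p)"
    using assms by simp
  ultimately show ?thesis
    by (simp add: sum.distrib)
qed

section \<open>The average distance\<close>

text \<open>Passing from p to p + 1 adds a row and a column, each with sum p (p + 1) / 2. This is
  the source of the main term 1/3.\<close>

lemma sum_abs_diff_square:
  "3 * (\<Sum>s = 0..<int p. \<Sum>m = 0..<int p. \<bar>m - s\<bar>) = int p ^ 3 - int p"
proof (induction p)
  case (Suc p)
  have ins: "{0..<int (Suc p)} = insert (int p) {0..<int p}"
    by auto
  have tri: "2 * (\<Sum>m = 0..<int p. int p - m) = int p * (int p + 1)"
  proof (induction p)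
    case (Suc p)
    have "{0..<int (Suc p)} = insert (int p) {0..<int p}"
      by auto
    then show ?case
      using Suc by (simp add: algebra_simps sum.distrib sum_subtractf)
  qed simp
  have "(\<Sum>m = 0..<int p. \<bar>int p - m\<bar>) = (\<Sum>m = 0..<int p. int p - m)"
    "(\<Sum>m = 0..<int p. \<bar>m - int p\<bar>) = (\<Sum>m = 0..<int p. int p - m)"
    by (auto intro!: sum.cong)
  then have "(\<Sum>s = 0..<int (Suc p). \<Sum>m = 0..<int (Suc p). \<bar>m - s\<bar>)
      = (\<Sum>s = 0..<int p. \<Sum>m = 0..<int p. \<bar>m - s\<bar>) + 2 * (\<Sum>m = 0..<int p. int p - m)"
    unfolding ins by (simp add: sum.distrib)
  then show ?case
    using Suc tri by (simp add: algebra_simps eval_nat_numeral)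
qed simp

text \<open>With e = d mod p, rotation moves p - e points by e and the e points that wrap around by
  p - e, in total 2 e (p - e). For d \<ge> 0 the factor e is at most |d|, otherwise p - e
  is.\<close>

lemma sum_abs_rotation_le:
  assumes "p > 0"
  shows "(\<Sum>s = 0..<int p. \<bar>(s + d) mod int p - s\<bar>) \<le> 2 * int p * \<bar>d\<bar>"
proof -
  define e where "e = d mod int p"
  have e: "0 \<le> e" "e < int p"
    using assms by (auto simp: e_def)
  have "(\<Sum>s = 0..<int p. \<bar>(s + d) mod int p - s\<bar>) = (\<Sum>s = 0..<int p. if s < int p - e then e else int p - e)"
  proof (rule sum.cong[OF refl])
    fix s assume s: "s \<in> {0..<int p}"
    have "(s + d) mod int p = (s + e) mod int p"
      by (simp add: e_def mod_simps)
    also have "\<dots> = (if s < int p - e then s + e else s + e - int p)"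
      using s e minus_mod_self2[of "s + e" "int p"] mod_pos_pos_trivial[of "s + e - int p" "int p"]
      by auto
    finally show "\<bar>(s + d) mod int p - s\<bar> = (if s < int p - e then e else int p - e)"
      using e by auto
  qed
  also have "\<dots> = (\<Sum>s\<in>{0..<int p} \<inter> {s. s < int p - e}. e) + (\<Sum>s\<in>{0..<int p} \<inter> - {s. s < int p - e}. int p - e)"
    by (rule sum.If_cases) simp
  also have "{0..<int p} \<inter> {s. s < int p - e} = {0..<int p - e}"
    using e by auto
  also have "{0..<int p} \<inter> - {s. s < int p - e} = {int p - e..<int p}"
    using e by auto
  also have "(\<Sum>s\<in>{0..<int p - e}. e) + (\<Sum>s\<in>{int p - e..<int p}. int p - e) = 2 * (e * (int p - e))"
    using e by simp
  also have "e * (int p - e) \<le> int p * \<bar>d\<bar>"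
  proof (cases "d \<ge> 0")
    case True
    then have "e \<le> \<bar>d\<bar>"
      using e assms by (simp add: e_def zmod_le_nonneg_dividend)
    then have "e * (int p - e) \<le> \<bar>d\<bar> * int p"
      using e by (intro mult_mono) auto
    then show ?thesis
      by (simp add: mult.commute)
  next
    case False
    have "int p dvd e - d"
      by (simp add: e_def mod_eq_dvd_iff[symmetric])
    then have "int p \<le> e - d"
      using e False by (intro zdvd_imp_le) auto
    then show ?thesis
      using e by (intro mult_mono) auto
  qed
  finally show ?thesis
    by (simp add: mult.assoc)
qed

text \<open>In the error, 2 A B + 2 comes from truncating ranges of summation, the term with C from
  leaving the argument of r unshifted, and the last from the nonzero frequencies. U stands for an
  upper bound of the fourth root in \<open>burgess_bound\<close>.\<close>

lemma fermat_quotient_average: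
  fixes C :: int and A B :: nat
  assumes p: "prime p" "odd p" and B: "int B ^ 2 \<le> int p" "B \<ge> 1" and C: "\<not> int p dvd C"
    and A: "A \<ge> 1" "A * B + 1 < p"
    and U: "0 \<le> U" "4 * real A ^ 3 * real p ^ 6 * (1 + ln (real p)) ^ 2 \<le> U ^ 4"
  shows "\<bar>(\<Sum>b = 1..int p - 1. real_of_int \<bar>fermat_quotient p b - C * b mod int p\<bar> / real p) - real p / 3\<bar>
    \<le> 2 * real (A * B) + 2 + 2 * \<bar>real_of_int C\<bar> * real (A * B) + 2 * (1 + ln (real p)) * U / real (A * B)"
proof -
  define H where "H = A * B"
  \<comment> \<open>With this N, every n + a b stays in {1..p - 1}, so p never divides it.\<close>
  define N where "N = p - 1 - H"
  define G where "G s m = real_of_int \<bar>m - s\<bar> / real p" for s m :: int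
  define q where "q = fermat_quotient p"
  define r where "r b = (C * b) mod int p" for b
  define F where "F b = G (r b) (q b)" for b
  define \<mu> where "\<mu> s = (\<Sum>m = 0..<int p. G s m) / real p" for s
  define S where "S = (\<Sum>b = 1..int p - 1. F b)"
  define X where "X = {1..int A} \<times> {1..int N}"
  define w where "w c = 1 / real_of_int c + 1 / (real p - real_of_int c)" for c
  have p0: "p > 0" "prime (int p)" "p \<ge> 2" "real p > 0"
    using p prime_gt_0_nat prime_ge_2_nat by auto
  have H: "H \<ge> 1" "N \<ge> 1" "N < p" "N + H = p - 1"
    using A B by (auto simp: H_def N_def)
  have ab: "a * b \<in> {1..int H}" if "a \<in> {1..int A}" "b \<in> {1..int B}" for a b
  proof -
    have "a * b \<le> int A * int B"
      using that by (intro mult_mono) auto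
    moreover have "0 < a * b"
      using that by simp
    ultimately show ?thesis
      by (simp add: H_def)
  qed
  have Ap: "A < p"
  proof -
    have "A * 1 \<le> A * B"
      using B(2) by (intro mult_le_mono2)
    then show ?thesis
      using A(2) by linarith
  qed
  have r: "r b \<in> {0..<int p}" and q: "q b \<in> {0..<int p}" for b
    using p0 by (simp_all add: r_def q_def fermat_quotient_bounds)
  have G01: "0 \<le> G s m \<and> G s m \<le> 1" if "s \<in> {0..<int p}" "m \<in> {0..<int p}" for s m
    using that p0 by (auto simp: G_def field_simps)
  have F01: "0 \<le> F b \<and> F b \<le> 1" for b
    unfolding F_def by (intro G01 r q)
  have inj: "inj_on r {0..<int p}"
  proof (rule inj_onI)
    fix x y assume xy: "x \<in> {0..<int p}" "y \<in> {0..<int p}" and "r x = r y"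
    then have "[C * x = C * y] (mod int p)"
      by (simp add: r_def unique_euclidean_semiring_class.cong_def)
    then have "[x = y] (mod int p)"
      by (rule cong_cancel_prime[OF p0(2) C])
    then show "x = y"
      using xy by (intro cong_less_imp_eq_int[of _ "int p"]) auto
  qed
  have image: "r ` {0..<int p} = {0..<int p}"
    using r by (intro endo_inj_surj inj) auto
  have sub: "{1..int N} \<subseteq> {0..<int p}"
    using H by auto

  \<comment> \<open>The shifted window omits exactly H of the p - 1 terms, each in [0, 1].\<close>
  have step1: "\<bar>S - (\<Sum>n = 1..int N. F (n + k))\<bar> \<le> real H" if k: "k \<in> {1..int H}" for k
  proof -
    define D where "D = {1..int p - 1} - {1 + k..int N + k}"
    have sb: "{1 + k..int N + k} \<subseteq> {1..int p - 1}"
      using k H by auto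
    have "(\<Sum>n = 1..int N. F (n + k)) = (\<Sum>b = 1 + k..int N + k. F b)"
      by (rule sum.reindex_bij_witness[of _ "\<lambda>b. b - k" "\<lambda>n. n + k"]) auto
    then have eq: "S - (\<Sum>n = 1..int N. F (n + k)) = (\<Sum>b\<in>D. F b)"
      unfolding S_def D_def using sum_diff[OF _ sb, of F] by simp
    have "card D = H"
      using sb H by (simp add: D_def card_Diff_subset)
    moreover have "(\<Sum>b\<in>D. F b) \<le> (\<Sum>b\<in>D. 1)"
      using F01 by (intro sum_mono) auto
    moreover have "0 \<le> (\<Sum>b\<in>D. F b)"
      using F01 by (intro sum_nonneg) auto
    ultimately show ?thesis
      unfolding eq by simp
  qed

  \<comment> \<open>r(n + k) is r(n) rotated by C k. As r permutes the residues, the total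
    displacement is that of one rotation of Z/p.\<close>
  have step2: "\<bar>(\<Sum>n = 1..int N. F (n + k)) - (\<Sum>n = 1..int N. G (r n) (q (n + k)))\<bar>
      \<le> 2 * \<bar>real_of_int C\<bar> * real H" if k: "k \<in> {1..int H}" for k
  proof -
    have "(\<Sum>n = 1..int N. \<bar>r (n + k) - r n\<bar>) = (\<Sum>n = 1..int N. \<bar>(r n + C * k) mod int p - r n\<bar>)"
      by (simp add: r_def mod_simps distrib_left)
    also have "\<dots> \<le> (\<Sum>n = 0..<int p. \<bar>(r n + C * k) mod int p - r n\<bar>)"
      using sub by (intro sum_mono2) auto
    also have "\<dots> = (\<Sum>s\<in>r ` {0..<int p}. \<bar>(s + C * k) mod int p - s\<bar>)"
      by (simp add: sum.reindex[OF inj])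
    also have "\<dots> \<le> 2 * int p * \<bar>C * k\<bar>"
      unfolding image by (rule sum_abs_rotation_le[OF p0(1)])
    also have "\<bar>C * k\<bar> \<le> \<bar>C\<bar> * int H"
      using k by (simp add: abs_mult mult_left_mono)
    finally have "(\<Sum>n = 1..int N. \<bar>r (n + k) - r n\<bar>) \<le> 2 * int p * (\<bar>C\<bar> * int H)"
      by (simp add: mult_left_mono)
    then have "real_of_int (\<Sum>n = 1..int N. \<bar>r (n + k) - r n\<bar>) \<le> real_of_int (2 * int p * (\<bar>C\<bar> * int H))"
      by (simp only: of_int_le_iff)
    also have "\<dots> = 2 * real p * (\<bar>real_of_int C\<bar> * real H)"
      by simp
    finally have le: "real_of_int (\<Sum>n = 1..int N. \<bar>r (n + k) - r n\<bar>) \<le> 2 * real p * (\<bar>real_of_int C\<bar> * real H)" .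
    have "\<bar>(\<Sum>n = 1..int N. F (n + k)) - (\<Sum>n = 1..int N. G (r n) (q (n + k)))\<bar>
        \<le> (\<Sum>n = 1..int N. \<bar>F (n + k) - G (r n) (q (n + k))\<bar>)"
      unfolding sum_subtractf[symmetric] by (rule sum_abs)
    also have "\<dots> \<le> (\<Sum>n = 1..int N. real_of_int \<bar>r (n + k) - r n\<bar> / real p)"
    proof (rule sum_mono)
      fix n
      have "F (n + k) - G (r n) (q (n + k))
          = (real_of_int \<bar>q (n + k) - r (n + k)\<bar> - real_of_int \<bar>q (n + k) - r n\<bar>) / real p"
        by (simp add: F_def G_def diff_divide_distrib)
      moreover have "\<bar>real_of_int \<bar>q (n + k) - r (n + k)\<bar> - real_of_int \<bar>q (n + k) - r n\<bar>\<bar>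
          \<le> real_of_int \<bar>r (n + k) - r n\<bar>"
        by linarith
      ultimately show "\<bar>F (n + k) - G (r n) (q (n + k))\<bar> \<le> real_of_int \<bar>r (n + k) - r n\<bar> / real p"
        using p0 by (simp add: abs_divide divide_right_mono)
    qed
    also have "\<dots> = real_of_int (\<Sum>n = 1..int N. \<bar>r (n + k) - r n\<bar>) / real p"
      by (simp add: sum_divide_distrib)
    also have "\<dots> \<le> (2 * real p * (\<bar>real_of_int C\<bar> * real H)) / real p"
      by (intro divide_right_mono le) simp
    finally show ?thesis
      using p0 by simp
  qed

  have step3: "\<bar>(\<Sum>(a, n)\<in>X. \<Sum>b = 1..int B. G (r n) (q (n + a * b))) - (\<Sum>(a, n)\<in>X. real B * \<mu> (r n))\<bar>
      \<le> 2 * (1 + ln (real p)) * U"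
  proof -
    define ft where "ft n = ftransform p (G (r n))" for n
    have expand: "complex_of_real (G (r n) (q (n + a * b)))
        = of_real (\<mu> (r n)) + (\<Sum>c = 1..<int p. ft n c * chi p c (n + a * b))"
      if "(a, n) \<in> X" "b \<in> {1..int B}" for a n b
    proof -
      have "1 \<le> n + a * b" "n + a * b < int p"
        using that ab[of a b] H by (auto simp: X_def)
      then have nd: "\<not> int p dvd n + a * b"
        using zdvd_not_zless[of "n + a * b" "int p"] by auto
      have ins: "{0..<int p} = insert 0 {1..<int p}"
        using p0 by auto
      have "complex_of_real (G (r n) (q (n + a * b))) = (\<Sum>c = 0..<int p. ft n c * ee p (c * q (n + a * b)))"
        unfolding ft_def by (intro ftransform_inversion p0 q)
      also have "\<dots> = ft n 0 + (\<Sum>c = 1..<int p. ft n c * ee p (c * q (n + a * b)))"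
        unfolding ins by simp
      also have "ft n 0 = of_real (\<mu> (r n))"
        by (simp add: ft_def ftransform_def \<mu>_def)
      finally show ?thesis
        using nd by (simp add: chi_def q_def)
    qed
    have inner: "complex_of_real (\<Sum>b = 1..int B. G (r n) (q (n + a * b))) - of_real (real B * \<mu> (r n))
        = (\<Sum>c = 1..<int p. ft n c * (\<Sum>b = 1..int B. chi p c (n + a * b)))" if "(a, n) \<in> X" for a n
    proof -
      have "complex_of_real (\<Sum>b = 1..int B. G (r n) (q (n + a * b)))
          = (\<Sum>b = 1..int B. of_real (\<mu> (r n)) + (\<Sum>c = 1..<int p. ft n c * chi p c (n + a * b)))"
        unfolding of_real_sum by (intro sum.cong refl expand that)
      also have "\<dots> = of_real (real B * \<mu> (r n)) + (\<Sum>b = 1..int B. \<Sum>c = 1..<int p. ft n c * chi p c (n + a * b))"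
        by (simp add: sum.distrib)
      also have "(\<Sum>b = 1..int B. \<Sum>c = 1..<int p. ft n c * chi p c (n + a * b))
          = (\<Sum>c = 1..<int p. ft n c * (\<Sum>b = 1..int B. chi p c (n + a * b)))"
        by (subst sum.swap) (simp add: sum_distrib_left)
      finally show ?thesis
        by simp
    qed
    have "complex_of_real ((\<Sum>(a, n)\<in>X. \<Sum>b = 1..int B. G (r n) (q (n + a * b))) - (\<Sum>(a, n)\<in>X. real B * \<mu> (r n)))
        = (\<Sum>(a, n)\<in>X. complex_of_real (\<Sum>b = 1..int B. G (r n) (q (n + a * b))) - of_real (real B * \<mu> (r n)))"
      by (simp add: case_prod_unfold flip: sum_subtractf)
    also have "\<dots> = (\<Sum>(a, n)\<in>X. \<Sum>c = 1..<int p. ft n c * (\<Sum>b = 1..int B. chi p c (n + a * b)))"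
      using inner by (intro sum.cong refl) auto
    also have "\<dots> = (\<Sum>c = 1..<int p. \<Sum>(a, n)\<in>X. ft n c * (\<Sum>b = 1..int B. chi p c (n + a * b)))"
      unfolding case_prod_unfold by (rule sum.swap)
    finally have eq: "complex_of_real ((\<Sum>(a, n)\<in>X. \<Sum>b = 1..int B. G (r n) (q (n + a * b))) - (\<Sum>(a, n)\<in>X. real B * \<mu> (r n)))
        = (\<Sum>c = 1..<int p. \<Sum>(a, n)\<in>X. ft n c * (\<Sum>b = 1..int B. chi p c (n + a * b)))" .
    have "\<bar>(\<Sum>(a, n)\<in>X. \<Sum>b = 1..int B. G (r n) (q (n + a * b))) - (\<Sum>(a, n)\<in>X. real B * \<mu> (r n))\<bar>
        = norm (\<Sum>c = 1..<int p. \<Sum>(a, n)\<in>X. ft n c * (\<Sum>b = 1..int B. chi p c (n + a * b)))"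
      by (simp only: eq[symmetric] norm_of_real)
    also have "\<dots> \<le> (\<Sum>c = 1..<int p. w c * U)"
    proof (rule sum_norm_le)
      \<comment> \<open>The coefficient \<open>ft n c\<close> depends on n, but its bound
        \<open>w c\<close> does not. It can thus be pulled out, because \<open>burgess_bound\<close>
        has norms inside the sum over a and n.\<close>
      fix c assume c: "c \<in> {1..<int p}"
      then have w0: "0 \<le> w c"
        by (simp add: w_def)
      have ndc: "\<not> int p dvd c"
        using c zdvd_not_zless[of c "int p"] by auto
      have "norm (\<Sum>(a, n)\<in>X. ft n c * (\<Sum>b = 1..int B. chi p c (n + a * b)))
          \<le> (\<Sum>(a, n)\<in>X. w c * norm (\<Sum>b = 1..int B. chi p c (n + a * b)))"
      proof (rule sum_norm_le, clarify)
        fix a n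
        have "norm (ft n c) \<le> w c"
          using norm_ftransform_dist_le[OF r c] unfolding ft_def w_def G_def .
        then show "norm (ft n c * (\<Sum>b = 1..int B. chi p c (n + a * b)))
            \<le> w c * norm (\<Sum>b = 1..int B. chi p c (n + a * b))"
          unfolding norm_mult by (intro mult_right_mono) auto
      qed
      also have "\<dots> = w c * (\<Sum>(a, n)\<in>X. norm (\<Sum>b = 1..int B. chi p c (n + a * b)))"
        by (simp add: sum_distrib_left case_prod_unfold)
      also have "(\<Sum>(a, n)\<in>X. norm (\<Sum>b = 1..int B. chi p c (n + a * b))) \<le> U"
      proof (rule power_le_imp_le_base)
        show "(\<Sum>(a, n)\<in>X. norm (\<Sum>b = 1..int B. chi p c (n + a * b))) ^ Suc 3 \<le> U ^ Suc 3"
          using burgess_bound[OF p B(1) ndc A(1) Ap H(2,3)] U(2) unfolding X_def by simp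
      qed (rule U(1))
      finally show "norm (\<Sum>(a, n)\<in>X. ft n c * (\<Sum>b = 1..int B. chi p c (n + a * b))) \<le> w c * U"
        using w0 by (simp add: mult_left_mono)
    qed
    also have "\<dots> = (\<Sum>c = 1..<int p. w c) * U"
      by (simp add: sum_distrib_right)
    also have "\<dots> \<le> 2 * (1 + ln (real p)) * U"
      unfolding w_def by (intro mult_right_mono sum_ftransform_bound p0 U)
    finally show ?thesis .
  qed

  \<comment> \<open>Over all residues the means \<open>\<mu>\<close> add up to p/3 - 1/(3 p); the H
    + 1 residues outside {1..N} contribute at most 1 each.\<close>
  have step4: "\<bar>(\<Sum>n = 1..int N. \<mu> (r n)) - real p / 3\<bar> \<le> real H + 2"
  proof -
    have mu01: "0 \<le> \<mu> s \<and> \<mu> s \<le> 1" if "s \<in> {0..<int p}" for s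
    proof -
      have "(\<Sum>m = 0..<int p. G s m) \<le> (\<Sum>m = 0..<int p. 1)"
        using G01[OF that] by (intro sum_mono) auto
      moreover have "0 \<le> (\<Sum>m = 0..<int p. G s m)"
        using G01[OF that] by (intro sum_nonneg) auto
      ultimately show ?thesis
        using p0 by (simp add: \<mu>_def)
    qed
    define D where "D = {0..<int p} - {1..int N}"
    have cD: "card D = H + 1"
      using sub H by (simp add: D_def card_Diff_subset)
    have diff: "(\<Sum>n = 0..<int p. \<mu> (r n)) - (\<Sum>n = 1..int N. \<mu> (r n)) = (\<Sum>n\<in>D. \<mu> (r n))"
      unfolding D_def using sum_diff[OF _ sub, of "\<lambda>n. \<mu> (r n)"] by simp
    have "(\<Sum>n\<in>D. \<mu> (r n)) \<le> (\<Sum>n\<in>D. 1)" and ge: "0 \<le> (\<Sum>n\<in>D. \<mu> (r n))"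
      by (rule sum_mono, use mu01[OF r] in blast) (rule sum_nonneg, use mu01[OF r] in blast)
    then have le: "(\<Sum>n\<in>D. \<mu> (r n)) \<le> real H + 1"
      by (simp add: cD)
    have "(\<Sum>n = 0..<int p. \<mu> (r n)) = (\<Sum>s\<in>r ` {0..<int p}. \<mu> s)"
      by (simp add: sum.reindex[OF inj])
    also have "\<dots> = (\<Sum>s = 0..<int p. \<mu> s)"
      unfolding image ..
    also have "\<dots> = real_of_int (\<Sum>s = 0..<int p. \<Sum>m = 0..<int p. \<bar>m - s\<bar>) / real p ^ 2"
      by (simp add: \<mu>_def G_def power2_eq_square flip: sum_divide_distrib)
    also have "real_of_int (\<Sum>s = 0..<int p. \<Sum>m = 0..<int p. \<bar>m - s\<bar>) = (real p ^ 3 - real p) / 3"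
    proof -
      have "real_of_int (3 * (\<Sum>s = 0..<int p. \<Sum>m = 0..<int p. \<bar>m - s\<bar>)) = real_of_int (int p ^ 3 - int p)"
        unfolding sum_abs_diff_square ..
      then show ?thesis
        by simp
    qed
    also have "(real p ^ 3 - real p) / 3 / real p ^ 2 = real p / 3 - 1 / (3 * real p)"
      using p0 by (simp add: field_simps eval_nat_numeral)
    finally have "(\<Sum>n = 0..<int p. \<mu> (r n)) = real p / 3 - 1 / (3 * real p)" .
    moreover have "0 \<le> 1 / (3 * real p)" "1 / (3 * real p) \<le> 1"
      using p0 by (auto simp: field_simps)
    ultimately show ?thesis
      using diff le ge by linarith
  qed

  have factor: "\<bar>real H * x - real H * y\<bar> = real H * \<bar>x - y\<bar>" for x y :: real
    by (simp only: abs_mult abs_of_nat flip: right_diff_distrib)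
  have const: "(\<Sum>a = 1..int A. \<Sum>b = 1..int B. x) = real H * x" for x :: real
    by (simp add: H_def)
  define V where "V = (\<Sum>a = 1..int A. \<Sum>b = 1..int B. \<Sum>n = 1..int N. G (r n) (q (n + a * b)))"
  define M where "M = (\<Sum>n = 1..int N. \<mu> (r n))"
  \<comment> \<open>Everything is summed over the H = A B pairs (a, b); the factor H is divided out
    at the end.\<close>
  have "\<bar>(\<Sum>a = 1..int A. \<Sum>b = 1..int B. S) - V\<bar>
      \<le> (\<Sum>a = 1..int A. \<Sum>b = 1..int B. real H + 2 * \<bar>real_of_int C\<bar> * real H)"
    unfolding V_def sum_subtractf[symmetric]
  proof (intro order.trans[OF sum_abs] sum_mono)
    fix a b assume "a \<in> {1..int A}" "b \<in> {1..int B}"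
    then have k: "a * b \<in> {1..int H}"
      by (rule ab)
    show "\<bar>S - (\<Sum>n = 1..int N. G (r n) (q (n + a * b)))\<bar> \<le> real H + 2 * \<bar>real_of_int C\<bar> * real H"
      using step1[OF k] step2[OF k] by linarith
  qed
  then have e1: "\<bar>real H * S - V\<bar> \<le> real H * (real H + 2 * \<bar>real_of_int C\<bar> * real H)"
    unfolding const .
  have "V = (\<Sum>(a, n)\<in>X. \<Sum>b = 1..int B. G (r n) (q (n + a * b)))"
    unfolding V_def X_def sum.cartesian_product[symmetric] by (intro sum.cong refl sum.swap)
  moreover have "(\<Sum>(a, n)\<in>X. real B * \<mu> (r n)) = real H * M"
    unfolding X_def M_def sum.cartesian_product[symmetric] by (simp add: H_def sum_distrib_left mult.assoc)
  ultimately have e2: "\<bar>V - real H * M\<bar> \<le> 2 * (1 + ln (real p)) * U"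
    using step3 by simp
  have "real H * \<bar>M - real p / 3\<bar> \<le> real H * (real H + 2)"
    unfolding M_def by (intro mult_left_mono step4) simp
  then have e3: "\<bar>real H * M - real H * (real p / 3)\<bar> \<le> real H * (real H + 2)"
    unfolding factor .
  have "\<bar>real H * S - real H * (real p / 3)\<bar>
      \<le> real H * (real H + 2 * \<bar>real_of_int C\<bar> * real H) + 2 * (1 + ln (real p)) * U + real H * (real H + 2)"
    using e1 e2 e3 by linarith
  also have "\<dots> = real H * (2 * real H + 2 + 2 * \<bar>real_of_int C\<bar> * real H + 2 * (1 + ln (real p)) * U / real H)"
  proof -
    have "real H * (K / real H) = K" for K
      using H(1) by simp
    then show ?thesis
      by (simp only: distrib_left)
  qed
  finally have "real H * \<bar>S - real p / 3\<bar>
      \<le> real H * (2 * real H + 2 + 2 * \<bar>real_of_int C\<bar> * real H + 2 * (1 + ln (real p)) * U / real H)"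
    unfolding factor .
  then have "\<bar>S - real p / 3\<bar> \<le> 2 * real H + 2 + 2 * \<bar>real_of_int C\<bar> * real H + 2 * (1 + ln (real p)) * U / real H"
    using H(1) by (simp add: mult_le_cancel_left_pos)
  then show ?thesis
    by (simp add: S_def F_def G_def r_def q_def H_def)
qed

section \<open>Fractional parts, choice of A and B, and the asymptotic statement\<close>

lemma eventually_primes_at_top:
  assumes "eventually P at_top"
  shows "eventually (\<lambda>p. prime p \<and> P p) primes_at_top"
  using assms unfolding primes_at_top_def eventually_inf_principal
  by (rule eventually_mono) simp

text \<open>The real number and the reduced residue over p differ by the integer quotient plus
  d.\<close>

lemma frac_eq_mod:
  assumes "p > 0"
  shows "frac (real_of_int c * (real b / real p) + real_of_int d) = real_of_int (c * int b mod int p) / real p"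
  unfolding frac_unique_iff
proof (intro conjI)
  define k where "k = c * int b div int p"
  define m where "m = c * int b mod int p"
  have "c * int b = k * int p + m"
    by (simp add: k_def m_def)
  then have "real_of_int c * real b = real_of_int k * real p + real_of_int m"
    by (metis of_int_add of_int_mult of_int_of_nat_eq)
  then have "real_of_int c * (real b / real p) + real_of_int d - real_of_int (c * int b mod int p) / real p
      = real_of_int (k + d)"
    using assms unfolding m_def[symmetric] by (simp add: field_simps)
  then show "real_of_int c * (real b / real p) + real_of_int d - real_of_int (c * int b mod int p) / real p \<in> \<int>"
    by (simp only: Ints_of_int)
  have "real_of_int (c * int b mod int p) < real_of_int (int p)"
    using assms by (simp only: of_int_less_iff) simp
  then show "real_of_int (c * int b mod int p) / real p < 1"
    using assms by simp
qed (use assms in simp)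

lemma floor_ge_half:
  fixes x :: real
  assumes "x \<ge> 1"
  shows "x / 2 \<le> real (nat \<lfloor>x\<rfloor>)" "real (nat \<lfloor>x\<rfloor>) \<le> x" "nat \<lfloor>x\<rfloor> \<ge> 1"
proof -
  have "1 \<le> \<lfloor>x\<rfloor>"
    using assms by (simp add: le_floor_iff)
  then have "real (nat \<lfloor>x\<rfloor>) = of_int \<lfloor>x\<rfloor>" "1 \<le> real_of_int \<lfloor>x\<rfloor>" "nat \<lfloor>x\<rfloor> \<ge> 1"
    by (auto simp: le_nat_iff)
  then show "x / 2 \<le> real (nat \<lfloor>x\<rfloor>)" "real (nat \<lfloor>x\<rfloor>) \<le> x" "nat \<lfloor>x\<rfloor> \<ge> 1"
    by linarith+
qed

text \<open>A and B are p^(5/12) and p^(1/2) rounded down, so A B is p^(11/12) up to a factor 4. The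
  size hypothesis ensures A B + 1 < p.\<close>

lemma fermat_quotient_average_powr:
  assumes p: "prime p" "odd p" and C: "\<not> int p dvd C" and large: "real p powr (11/12) + 1 < real p"
  shows "\<bar>(\<Sum>b = 1..int p - 1. real_of_int \<bar>fermat_quotient p b - C * b mod int p\<bar> / real p) - real p / 3\<bar>
    \<le> 6 * \<bar>real_of_int C\<bar> * real p powr (11/12) + 16 * (1 + ln (real p))\<^sup>2 * real p powr (43/48)"
proof -
  define x where "x = real p"
  define A where "A = nat \<lfloor>x powr (5/12)\<rfloor>"
  define B where "B = nat \<lfloor>x powr (1/2)\<rfloor>"
  define L where "L = 1 + ln x"
  \<comment> \<open>Since (5/12) 3 + 6 = 29/4, the fourth root has exponent 29/16. The constant 4
    and the factor L^2 are enlarged to 16 and L^4 to obtain an exact fourth power.\<close>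
  define U where "U = 2 * x powr (29/16) * L"
  have x: "x \<ge> 1"
    using p(1) prime_gt_0_nat[of p] by (simp add: x_def)
  then have L: "L \<ge> 1"
    by (simp add: L_def)
  have A: "x powr (5/12) / 2 \<le> real A" "real A \<le> x powr (5/12)" "A \<ge> 1"
    unfolding A_def by (rule floor_ge_half; use x in \<open>simp add: ge_one_powr_ge_zero\<close>)+
  have B: "x powr (1/2) / 2 \<le> real B" "real B \<le> x powr (1/2)" "B \<ge> 1"
    unfolding B_def by (rule floor_ge_half; use x in \<open>simp add: ge_one_powr_ge_zero\<close>)+
  have "real A * real B \<le> x powr (5/12) * x powr (1/2)"
    using A B by (intro mult_mono) auto
  also have "\<dots> = x powr (11/12)"
    by (simp flip: powr_add)
  finally have AB: "real (A * B) \<le> x powr (11/12)"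
    by simp
  have "x powr (5/12) / 2 * (x powr (1/2) / 2) \<le> real A * real B"
    using A B by (intro mult_mono) auto
  moreover have "x powr (5/12) / 2 * (x powr (1/2) / 2) = x powr (11/12) / 4"
    by (simp flip: powr_add)
  ultimately have AB': "x powr (11/12) / 4 \<le> real (A * B)"
    by simp
  have B2: "int B ^ 2 \<le> int p"
  proof -
    have "real B ^ 2 \<le> (x powr (1/2)) ^ 2"
      using B by (intro power_mono) auto
    also have "\<dots> = real p"
      using x by (simp add: x_def powr_half_sqrt)
    finally have "real_of_int (int B ^ 2) \<le> real_of_int (int p)"
      by simp
    then show ?thesis
      by (simp only: of_int_le_iff)
  qed
  have lt: "A * B + 1 < p"
  proof -
    have "real (A * B + 1) < real p"
      using AB large by (simp add: x_def)
    then show ?thesis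
      by (simp only: of_nat_less_iff)
  qed
  have U4: "4 * real A ^ 3 * x ^ 6 * L ^ 2 \<le> U ^ 4"
  proof -
    have "4 * real A ^ 3 * x ^ 6 * L ^ 2 \<le> 16 * (x powr (5/12)) ^ 3 * x ^ 6 * L ^ 4"
      using A x L by (intro mult_mono power_mono power_increasing) auto
    also have "\<dots> = 16 * (x powr (5/4) * x powr 6) * L ^ 4"
      using x by (simp add: powr_power)
    also have "\<dots> = 16 * x powr (29/4) * L ^ 4"
      by (simp only: powr_add[symmetric]) simp
    also have "\<dots> = U ^ 4"
      using x by (simp add: U_def power_mult_distrib powr_power)
    finally show ?thesis .
  qed
  \<comment> \<open>The constant is 2 times 2 from U times 4 from rounding, and 29/16 - 11/12 =
    43/48.\<close>
  have "2 * L * U / real (A * B) \<le> 2 * L * U / (x powr (11/12) / 4)"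
    using AB' x L A(3) B(3) by (intro divide_left_mono) (auto simp: U_def intro!: mult_pos_pos)
  also have "\<dots> = 16 * L\<^sup>2 * (x powr (29/16) / x powr (11/12))"
    by (simp add: U_def power2_eq_square)
  also have "x powr (29/16) / x powr (11/12) = x powr (43/48)"
    by (simp flip: powr_diff)
  finally have last: "2 * L * U / real (A * B) \<le> 16 * L\<^sup>2 * x powr (43/48)" .
  have C1: "1 \<le> \<bar>real_of_int C\<bar>"
  proof -
    have "C \<noteq> 0"
      using C by auto
    then show ?thesis
      by linarith
  qed
  have c: "\<bar>real_of_int C\<bar> * real (A * B) \<le> \<bar>real_of_int C\<bar> * x powr (11/12)"
    using AB by (intro mult_left_mono) auto
  \<comment> \<open>As |C| \<ge> 1, the terms 2 A B and 2 are each at most 2 |C| p^(11/12); with the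
    shift term this gives the constant 6.\<close>
  have one: "1 * 1 \<le> \<bar>real_of_int C\<bar> * x powr (11/12)" "1 * x powr (11/12) \<le> \<bar>real_of_int C\<bar> * x powr (11/12)"
    using C1 x by (intro mult_mono; simp add: ge_one_powr_ge_zero)+
  have "\<bar>(\<Sum>b = 1..int p - 1. real_of_int \<bar>fermat_quotient p b - C * b mod int p\<bar> / real p) - real p / 3\<bar>
    \<le> 2 * real (A * B) + 2 + 2 * \<bar>real_of_int C\<bar> * real (A * B) + 2 * (1 + ln (real p)) * U / real (A * B)"
    by (rule fermat_quotient_average[OF p B2 B(3) C A(3) lt])
      (use U4 L x in \<open>auto simp: U_def x_def L_def\<close>)
  then show ?thesis
    using last c one AB unfolding x_def L_def by linarith
qed

theorem theorem1:
  fixes C D :: "nat \<Rightarrow> int"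
  assumes "\<And>p. prime p \<Longrightarrow> C p \<noteq> 0"
    and "(\<lambda>p. real_of_int (C p)) \<in>
           o[primes_at_top](\<lambda>p. real p powr (1/12) * ln (real p) powr (-2/3))"
  shows "(\<lambda>p. (1 / real p) *
              (\<Sum>b = 1..p - 1. \<bar>real_of_int (fermat_quotient p (int b)) / real p
                 - frac (real_of_int (C p) * (real b / real p) + real_of_int (D p))\<bar>)
            - 1 / 3)
         \<in> O[primes_at_top](\<lambda>p. \<bar>real_of_int (C p)\<bar> powr (3/5) * real p powr (-1/20)
                                  * ln (real p) powr (2/5))"
proof (rule bigoI[of _ 7])
  \<comment> \<open>The last condition holds because 5/48 > 1/20, so a power of p absorbs the
    logarithms. The constant 7 is 6 from the term with C plus 1 from this one.\<close>
  have "eventually (\<lambda>p::nat. p > 2 \<and> real p powr (11/12) + 1 < real p \<and> 1 \<le> ln (real p)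
      \<and> real p powr (1/12) * ln (real p) powr (-2/3) < real p
      \<and> 16 * (1 + ln (real p))\<^sup>2 * real p powr (-5/48) \<le> real p powr (-1/20) * ln (real p) powr (2/5)) at_top"
    by (intro eventually_conj eventually_gt_at_top; real_asymp)
  then have large: "eventually (\<lambda>p. prime p \<and> (p > 2 \<and> real p powr (11/12) + 1 < real p \<and> 1 \<le> ln (real p)
      \<and> real p powr (1/12) * ln (real p) powr (-2/3) < real p
      \<and> 16 * (1 + ln (real p))\<^sup>2 * real p powr (-5/48) \<le> real p powr (-1/20) * ln (real p) powr (2/5))) primes_at_top"
    by (rule eventually_primes_at_top)
  have small: "eventually (\<lambda>p. norm (real_of_int (C p)) \<le> 1 * norm (real p powr (1/12) * ln (real p) powr (-2/3))) primes_at_top"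
    by (rule landau_o.smallD[OF assms(2)]) simp
  show "eventually (\<lambda>p. norm ((1 / real p) *
              (\<Sum>b = 1..p - 1. \<bar>real_of_int (fermat_quotient p (int b)) / real p
                 - frac (real_of_int (C p) * (real b / real p) + real_of_int (D p))\<bar>)
            - 1 / 3)
         \<le> 7 * norm (\<bar>real_of_int (C p)\<bar> powr (3/5) * real p powr (-1/20)
                                  * ln (real p) powr (2/5))) primes_at_top"
    using large small
  proof eventually_elim
    case (elim p)
    define x where "x = real p"
    define l where "l = ln x"
    define c where "c = \<bar>real_of_int (C p)\<bar>"
    define S where "S = (\<Sum>b = 1..int p - 1. real_of_int \<bar>fermat_quotient p b - C p * b mod int p\<bar> / real p)"
    have p: "prime p" "odd p" "p > 0"
      using elim prime_odd_nat by auto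
    have x: "x > 0" and l: "l \<ge> 1"
      using elim by (auto simp: x_def l_def)
    have c_le: "c \<le> x powr (1/12) * l powr (-2/3)"
      using elim by (simp add: c_def x_def l_def)
    have c1: "c \<ge> 1"
      using assms(1)[OF p(1)] unfolding c_def by linarith
    \<comment> \<open>Being nonzero and smaller than p in absolute value, C_p is prime to p.\<close>
    have "c < x"
      using elim c_le by (simp add: x_def l_def)
    then have "\<not> int p dvd C p"
      using assms(1)[OF p(1)] zdvd_imp_le[of "int p" "\<bar>C p\<bar>"] by (auto simp: c_def x_def)
    then have "\<bar>S - x / 3\<bar> \<le> 6 * c * x powr (11/12) + 16 * (1 + l)\<^sup>2 * x powr (43/48)"
      using fermat_quotient_average_powr[OF p(1,2)] elim unfolding S_def x_def c_def l_def by blast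
    then have "\<bar>S - x / 3\<bar> / x \<le> (6 * c * x powr (11/12) + 16 * (1 + l)\<^sup>2 * x powr (43/48)) / x"
      using x by (intro divide_right_mono) auto
    also have "\<dots> = 6 * (c * x powr (-1/12)) + 16 * (1 + l)\<^sup>2 * x powr (-5/48)"
    proof -
      have "x powr (11/12) / x = x powr (-1/12)" "x powr (43/48) / x = x powr (-5/48)"
        using x powr_diff[of x "11/12" 1] powr_diff[of x "43/48" 1] by simp_all
      then show ?thesis
        by (simp add: add_divide_distrib flip: times_divide_eq_right)
    qed
    also have "\<dots> \<le> 7 * (c powr (3/5) * x powr (-1/20) * l powr (2/5))"
    proof -
      \<comment> \<open>Split c into c^(3/5) c^(2/5) and apply the growth bound to the second factor
        only. The exponent of p becomes 1/30 - 1/12 = -1/20, and l^(-4/15) is weakened to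
        l^(2/5).\<close>
      have "c powr (2/5) \<le> (x powr (1/12) * l powr (-2/3)) powr (2/5)"
        using c1 c_le by (intro powr_mono2) auto
      also have "\<dots> = x powr (1/30) * l powr (-4/15)"
        by (simp add: powr_mult powr_powr)
      also have "\<dots> \<le> x powr (1/30) * l powr (2/5)"
        using l by (intro mult_left_mono powr_mono) auto
      finally have "c powr (3/5) * c powr (2/5) * x powr (-1/12) \<le> c powr (3/5) * (x powr (1/30) * l powr (2/5)) * x powr (-1/12)"
        by (intro mult_right_mono mult_left_mono) auto
      also have "\<dots> = c powr (3/5) * (x powr (1/30) * x powr (-1/12)) * l powr (2/5)"
        by (simp add: mult_ac)
      also have "x powr (1/30) * x powr (-1/12) = x powr (-1/20)"
        by (simp flip: powr_add)
      also have "c powr (3/5) * c powr (2/5) = c"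
        using c1 by (simp flip: powr_add)
      finally have 1: "c * x powr (-1/12) \<le> c powr (3/5) * x powr (-1/20) * l powr (2/5)" .
      have "16 * (1 + l)\<^sup>2 * x powr (-5/48) \<le> 1 * (x powr (-1/20) * l powr (2/5))"
        using elim by (simp add: x_def l_def)
      \<comment> \<open>C_p is a nonzero integer, so c \<ge> 1 and the factor c^(3/5) can be
        inserted.\<close>
      also have "\<dots> \<le> c powr (3/5) * (x powr (-1/20) * l powr (2/5))"
        using c1 by (intro mult_right_mono) (auto simp: ge_one_powr_ge_zero)
      finally have 2: "16 * (1 + l)\<^sup>2 * x powr (-5/48) \<le> c powr (3/5) * x powr (-1/20) * l powr (2/5)"
        by (simp add: mult.assoc)
      show ?thesis
        using 1 2 by linarith
    qed
    finally have bound: "\<bar>S - x / 3\<bar> / x \<le> 7 * (c powr (3/5) * x powr (-1/20) * l powr (2/5))" .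
    have "(\<Sum>b = 1..p - 1. \<bar>real_of_int (fermat_quotient p (int b)) / real p
                 - frac (real_of_int (C p) * (real b / real p) + real_of_int (D p))\<bar>)
        = (\<Sum>b = 1..p - 1. real_of_int \<bar>fermat_quotient p (int b) - C p * int b mod int p\<bar> / real p)"
      unfolding frac_eq_mod[OF p(3)] by (simp add: abs_divide flip: diff_divide_distrib)
    also have "\<dots> = S"
      unfolding S_def by (rule sum.reindex_bij_witness[of _ nat int]) auto
    finally have eq: "(\<Sum>b = 1..p - 1. \<bar>real_of_int (fermat_quotient p (int b)) / real p
                 - frac (real_of_int (C p) * (real b / real p) + real_of_int (D p))\<bar>) = S" .
    have "1 / real p * S - 1 / 3 = (S - x / 3) / x"
      using x by (simp add: x_def field_simps)
    then show ?case
      unfolding eq using bound x by (simp add: c_def x_def l_def abs_divide abs_mult)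
  qed
qed

end
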